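(* Let $\prec$ be a normal Newton ordering on the monomials of $K[\mathbf{x}]=K[x_1,\ldots,x_n]$, given by a rational set $\mathcal{L}$ of linear forms, a shift $\delta\in\mathbb{Q}_{\ge0}^n$ and a semigroup ordering $\prec_0$. Let $G=\{f_1,\ldots,f_r\}\subseteq K[t,\mathbf{x}]$ be a finite set of homogeneous polynomials, $I=(f_1,\ldots,f_r)$, and let $f\in I$ be homogeneous. For each $l\in\mathcal{L}$ let $S_l$ be a finite set of monomials which generates $R(\{f|_{t=1}\})_\delta(l)$ over $R(l)$, and let $S=\bigcup_{l\in\mathcal{L}}S_l$. For every $\mathbf{x}^\beta\in S$ choose a monomial $\mathbf{x}^{\tilde\beta}\in\mathcal{M}$ with $LM(\mathbf{x}^{\tilde\beta}f|_{t=1})=\mathbf{x}^\beta$. Then $R=\{\mathbf{x}^{\tilde\beta}\mid\mathbf{x}^\beta\in S\}$ is a reducing set for $(f,G)$.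
   Context: $K$ is a field, $n\ge 1$, $\mathbb{N}=\{0,1,2,\ldots\}$, $\mathcal{M}=\{\mathbf{x}^{\alpha}\mid\alpha\in\mathbb{N}^n\}$. For a total ordering $\prec$ on $\mathcal{M}$ (not necessarily compatible with multiplication) and nonzero $f\in K[\mathbf{x}]$, $LM(f)$ is the $\prec$-largest monomial occurring in $f$, $LT(f)$ the corresponding term. For a finite set $G\subset K[\mathbf{x}]$, $L(G)=\{LM(\mathbf{x}^\alpha g)\mid \mathbf{x}^\alpha\in\mathcal{M}, g\in G\}$ (nonzero $g$ only). $\prec$ is normal if for all nonzero $f$ and $\mathbf{x}^\alpha\in\mathcal{M}$: $\mathbf{x}^\alpha\prec 1\Rightarrow LM(\mathbf{x}^\alpha f)\prec LM(f)$. Newton orderings: let $\mathcal{L}$ be a nonempty finite set of nonzero linear forms $l\colon\mathbb{R}^n\to\mathbb{R}$ and $\delta\in\mathbb{Q}_{\ge0}^n$. $\mathcal{L}$ is rational if for each $l\in\mathcal{L}$ the cone $C(l)=\{\alpha\in\mathbb{R}_{\ge0}^n\mid l(\alpha)=\min_{l'\in\mathcal{L}}l'(\alpha)\}$ is the locus where some finite set of linear forms with rational coefficients is nonnegative. Put $w_\delta(\mathbf{x}^\alpha)=\min\{l(\alpha+\delta)\mid l\in\mathcal{L}\}$. Given a semigroup ordering $\prec_0$ on $\mathcal{M}$, the Newton ordering is: $\mathbf{x}^\alpha\prec\mathbf{x}^\beta$ iff $w_\delta(\mathbf{x}^\alpha)>w_\delta(\mathbf{x}^\beta)$, or $w_\delta(\mathbf{x}^\alpha)=w_\delta(\mathbf{x}^\beta)$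 and $\mathbf{x}^\alpha\prec_0\mathbf{x}^\beta$. For $l\in\mathcal{L}$ let $\mathcal{M}_\delta(l)=\{\mathbf{x}^\alpha\in\mathcal{M}\mid w_\delta(\mathbf{x}^\alpha)=l(\alpha+\delta)\}$ and $\mathcal{M}(l)=\mathcal{M}_{\mathbf 0}(l)$ (the case $\delta=\mathbf 0$). $R(l)$ is the $K$-algebra spanned by $\mathcal{M}(l)$. For a finite set $G\subset K[\mathbf{x}]$, $R(G)_\delta(l)$ is the $K$-span of the monomials in $L(G)\cap\mathcal{M}_\delta(l)$; it is a finitely generated $R(l)$-module. Homogenisation. Let $t$ be a further variable, $\mathcal{T}_t$ the set of terms $c\,t^{\alpha_0}\mathbf{x}^\alpha$, $c\in K\setminus\{0\}$. On monomials of $K[t,\mathbf{x}]$ put $t^{\alpha_0}\mathbf{x}^\alpha\prec_h t^{\beta_0}\mathbf{x}^\beta$ iff $\alpha_0+|\alpha|<\beta_0+|\beta|$, or $\alpha_0+|\alpha|=\beta_0+|\beta|$ and $\mathbf{x}^\alpha\prec\mathbf{x}^\beta$; $LM$, $LT$ in $K[t,\mathbf{x}]$ are taken with respect to $\prec_h$, and $|_{t=1}$ is dehomogenisation. Algorithm NormalForm$(p,G)$. Input: $p\in K[t,\mathbf{x}]$ homogeneous, $G\subset K[t,\mathbf{x}]$ a finite ordered set of homogeneous polynomials. Set $h:=p$, $H:=\emptyset$. While $h\neq0$ and there exist $f\in G\cup H$, $\eta\in\mathcal{T}_t$, $\alpha\in\mathbb{N}$ with $LT(\eta f)=LT(t^\alpha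 h)$ and, if $f\in H$, $\eta\preceq 1$ (the monomial of $\eta|_{t=1}$ is $\preceq 1$), do: choose the first such $f$ with $\alpha$ minimal; if $\alpha>0$, set $H:=H\cup\{h\}$; set $h:=t^\alpha h-\eta f$; if $t\mid h$ and $h\neq 0$, divide $h$ by the maximal power of $t$ dividing it. Output: $h$. (For a normal Newton ordering this terminates.) Reducing sets. For $G\subset K[t,\mathbf{x}]$ a finite set of homogeneous polynomials and $f$ a homogeneous element of the ideal generated by $G$, a finite set $R(f,G)\subset\mathcal{M}$ is a reducing set for $(f,G)$ if for every $\mathbf{x}^\alpha\in\mathcal{M}$ there exist a homogeneous $g\in K[t,\mathbf{x}]$ with $LM(g|_{t=1})=1$, terms $\xi_1,\ldots,\xi_k\in\mathcal{T}_t$ and $h_1,\ldots,h_k\in G\cup\{\mathrm{NormalForm}(\mathbf{x}^\beta f,G)\mid\mathbf{x}^\beta\in R(f,G)\}$ such that $g\mathbf{x}^\alpha f=\sum_{i=1}^k\xi_ih_i$ with $LM(g\mathbf{x}^\alpha f)=LM(\xi_1h_1)\succ_h LM(\xi_ih_i)$ for $2\le i\le k$. *)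

theory Defs
  imports
    "HOL-Analysis.Cartesian_Space"
    "HOL-Library.Poly_Mapping"
    "HOL-Library.Product_Plus"
    "HOL-Library.While_Combinator"
begin

section \<open>Monomials and polynomials\<close>

text \<open>
  The variables \<open>x\<^sub>1, \<dots>, x\<^sub>n\<close> are indexed by a finite (hence nonempty) type \<open>'n\<close>. A monomial of
  \<open>K[x]\<close> is its exponent vector, a monomial \<open>t\<^sup>a x\<^sup>\<alpha>\<close> of \<open>K[t,x]\<close> is the pair \<open>(a, \<alpha>)\<close>, and a
  polynomial is a finitely supported map from monomials to coefficients. Multiplication of
  monomials is addition of exponents, so the monomial \<open>1\<close> is \<open>0\<close>.
\<close>

type_synonym 'n mon = "'n \<Rightarrow>\<^sub>0 nat"
type_synonym 'n tmon = "nat \<times> 'n mon"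
type_synonym ('n, 'k) pol = "'n mon \<Rightarrow>\<^sub>0 'k"
type_synonym ('n, 'k) tpol = "'n tmon \<Rightarrow>\<^sub>0 'k"

definition xmon :: "'n mon \<Rightarrow> ('n, 'k::field) pol"
  where "xmon \<alpha> = Poly_Mapping.single \<alpha> 1"

definition txmon :: "nat \<Rightarrow> 'n mon \<Rightarrow> ('n, 'k::field) tpol"
  where "txmon a \<alpha> = Poly_Mapping.single (a, \<alpha>) 1"

definition tdeg :: "'n::finite tmon \<Rightarrow> nat"
  where "tdeg m = fst m + (\<Sum>i\<in>UNIV. Poly_Mapping.lookup (snd m) i)"

definition homogeneous :: "('n::finite, 'k::field) tpol \<Rightarrow> bool"
  where "homogeneous p \<longleftrightarrow> (\<exists>d. \<forall>m\<in>Poly_Mapping.keys p. tdeg m = d)"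

definition dehom :: "('n, 'k::field) tpol \<Rightarrow> ('n, 'k) pol"
  where "dehom p =
    (\<Sum>m\<in>Poly_Mapping.keys p. Poly_Mapping.single (snd m) (Poly_Mapping.lookup p m))"

definition terms_t :: "('n, 'k::field) tpol set"
  where "terms_t = {Poly_Mapping.single m c | m c. c \<noteq> 0}"

definition ideal_gen :: "('n, 'k::field) tpol set \<Rightarrow> ('n, 'k) tpol set"
  where "ideal_gen = module.span (*)"

definition kspan :: "('n, 'k::field) pol set \<Rightarrow> ('n, 'k) pol set"
  where "kspan = module.span (\<lambda>c p. Poly_Mapping.single 0 c * p)"

lemma module_mult: "module ((*) :: ('n, 'k::field) tpol \<Rightarrow> _)"
  by standard (simp_all add: algebra_simps)

lemma module_scale: "module (\<lambda>c (p :: ('n, 'k::field) pol). Poly_Mapping.single 0 c * p)"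
  by standard
    (simp_all add: distrib_left distrib_right single_add mult_single single_one flip: mult.assoc)


section \<open>Orderings and leading terms\<close>

text \<open>Orderings are given by their strict part.\<close>

definition total_ordering :: "('m \<Rightarrow> 'm \<Rightarrow> bool) \<Rightarrow> bool"
  where "total_ordering lt \<longleftrightarrow> irreflp lt \<and> transp lt \<and> totalp lt"

definition semigroup_ordering :: "('n mon \<Rightarrow> 'n mon \<Rightarrow> bool) \<Rightarrow> bool"
  where "semigroup_ordering lt \<longleftrightarrow> total_ordering lt \<and>
    (\<forall>\<alpha> \<beta> \<gamma>. lt \<alpha> \<beta> \<longrightarrow> lt (\<alpha> + \<gamma>) (\<beta> + \<gamma>))"

text \<open>The next two notions are meaningful only for nonzero polynomials.\<close>

definition LM :: "('m \<Rightarrow> 'm \<Rightarrow> bool) \<Rightarrow> ('m \<Rightarrow>\<^sub>0 'k::zero) \<Rightarrow> 'm"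
  where "LM lt f =
    (THE m. m \<in> Poly_Mapping.keys f \<and> (\<forall>m'\<in>Poly_Mapping.keys f. m' \<noteq> m \<longrightarrow> lt m' m))"

definition LT :: "('m \<Rightarrow> 'm \<Rightarrow> bool) \<Rightarrow> ('m \<Rightarrow>\<^sub>0 'k::zero) \<Rightarrow> ('m \<Rightarrow>\<^sub>0 'k)"
  where "LT lt f = Poly_Mapping.single (LM lt f) (Poly_Mapping.lookup f (LM lt f))"

definition LMset :: "('n mon \<Rightarrow> 'n mon \<Rightarrow> bool) \<Rightarrow> ('n, 'k::field) pol set \<Rightarrow> 'n mon set"
  where "LMset lt G = {LM lt (xmon \<alpha> * g) | \<alpha> g. g \<in> G \<and> g \<noteq> 0}"

text \<open>Normality quantifies over polynomials, so it depends on the coefficient field.\<close>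

definition normal_ordering :: "'k::field itself \<Rightarrow> ('n mon \<Rightarrow> 'n mon \<Rightarrow> bool) \<Rightarrow> bool"
  where "normal_ordering _ lt \<longleftrightarrow>
    (\<forall>(f :: ('n, 'k) pol) \<alpha>. f \<noteq> 0 \<longrightarrow> lt \<alpha> 0 \<longrightarrow>
      lt (LM lt (xmon \<alpha> * f)) (LM lt f))"

definition hom_less :: "('n::finite mon \<Rightarrow> 'n mon \<Rightarrow> bool) \<Rightarrow> 'n tmon \<Rightarrow> 'n tmon \<Rightarrow> bool"
  where "hom_less lt m m' \<longleftrightarrow>
    tdeg m < tdeg m' \<or> tdeg m = tdeg m' \<and> lt (snd m) (snd m')"


section \<open>Newton orderings\<close>

definition expvec :: "'n::finite mon \<Rightarrow> real^'n"
  where "expvec \<alpha> = (\<chi> i. real (Poly_Mapping.lookup \<alpha> i))"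

definition form_cone :: "(real^'n \<Rightarrow> real) set \<Rightarrow> (real^'n \<Rightarrow> real) \<Rightarrow> (real^'n::finite) set"
  where "form_cone L l = {a. (\<forall>i. 0 \<le> a $ i) \<and> l a = (MIN l'\<in>L. l' a)}"

definition rational_forms :: "(real^'n::finite \<Rightarrow> real) set \<Rightarrow> bool"
  where "rational_forms L \<longleftrightarrow>
    (\<forall>l\<in>L. \<exists>\<Lambda> :: (real^'n \<Rightarrow> real) set. finite \<Lambda> \<and>
      (\<forall>c\<in>\<Lambda>. linear c \<and> (\<forall>i. c (axis i 1) \<in> \<rat>)) \<and>
      form_cone L l = {a. \<forall>c\<in>\<Lambda>. c a \<ge> 0})"

definition weight :: "(real^'n \<Rightarrow> real) set \<Rightarrow> real^'n \<Rightarrow> 'n::finite mon \<Rightarrow> real"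
  where "weight L \<delta> \<alpha> = (MIN l\<in>L. l (expvec \<alpha> + \<delta>))"

definition newton_less ::
    "(real^'n \<Rightarrow> real) set \<Rightarrow> real^'n \<Rightarrow> ('n mon \<Rightarrow> 'n mon \<Rightarrow> bool) \<Rightarrow>
      'n::finite mon \<Rightarrow> 'n mon \<Rightarrow> bool"
  where "newton_less L \<delta> less0 \<alpha> \<beta> \<longleftrightarrow>
    weight L \<delta> \<alpha> > weight L \<delta> \<beta> \<or> weight L \<delta> \<alpha> = weight L \<delta> \<beta> \<and> less0 \<alpha> \<beta>"

definition mon_cone ::
    "(real^'n \<Rightarrow> real) set \<Rightarrow> real^'n \<Rightarrow> (real^'n \<Rightarrow> real) \<Rightarrow> 'n::finite mon set"
  where "mon_cone L \<delta> l = {\<alpha>. weight L \<delta> \<alpha> = l (expvec \<alpha> + \<delta>)}"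

definition Ralg ::
    "(real^'n \<Rightarrow> real) set \<Rightarrow> (real^'n \<Rightarrow> real) \<Rightarrow> ('n::finite, 'k::field) pol set"
  where "Ralg L l = kspan (xmon ` mon_cone L 0 l)"

definition Rmod ::
    "(real^'n \<Rightarrow> real) set \<Rightarrow> real^'n \<Rightarrow> ('n mon \<Rightarrow> 'n mon \<Rightarrow> bool) \<Rightarrow>
      ('n, 'k::field) pol set \<Rightarrow> (real^'n \<Rightarrow> real) \<Rightarrow> ('n::finite, 'k) pol set"
  where "Rmod L \<delta> less0 G l =
    kspan (xmon ` (LMset (newton_less L \<delta> less0) G \<inter> mon_cone L \<delta> l))"

definition generates_over ::
    "('n, 'k::field) pol set \<Rightarrow> 'n mon set \<Rightarrow> ('n, 'k) pol set \<Rightarrow> bool"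
  where "generates_over A S M \<longleftrightarrow> M = {\<Sum>s\<in>S. r s * xmon s | r. \<forall>s\<in>S. r s \<in> A}"


section \<open>The normal form algorithm\<close>

definition strip_t :: "('n, 'k::field) tpol \<Rightarrow> ('n, 'k) tpol"
  where "strip_t h =
    (if h = 0 then 0 else THE q. h = txmon (GREATEST k. txmon k 0 dvd h) 0 * q)"

text \<open>
  \<open>H\<close> is kept as a list, in the order in which its elements were added; the elements of
  \<open>G \<union> H\<close> are searched in the order of \<open>G @ H\<close>. The last conjunct says that the monomial of
  \<open>\<eta>\<close> at \<open>t = 1\<close> is at most \<open>1\<close>.
\<close>

definition reduces_with ::
    "('n mon \<Rightarrow> 'n mon \<Rightarrow> bool) \<Rightarrow> ('n::finite, 'k::field) tpol list \<Rightarrow>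
      ('n, 'k) tpol \<Rightarrow> ('n, 'k) tpol \<Rightarrow> ('n, 'k) tpol \<Rightarrow> nat \<Rightarrow> bool"
  where "reduces_with lt H h f \<eta> a \<longleftrightarrow>
    f \<noteq> 0 \<and> \<eta> \<in> terms_t \<and>
    LT (hom_less lt) (\<eta> * f) = LT (hom_less lt) (txmon a 0 * h) \<and>
    (f \<in> set H \<longrightarrow> LM lt (dehom \<eta>) = 0 \<or> lt (LM lt (dehom \<eta>)) 0)"

fun nf_continue ::
    "('n mon \<Rightarrow> 'n mon \<Rightarrow> bool) \<Rightarrow> ('n::finite, 'k::field) tpol list \<Rightarrow>
      ('n, 'k) tpol \<times> ('n, 'k) tpol list \<Rightarrow> bool"
  where "nf_continue lt G (h, H) \<longleftrightarrow>
    h \<noteq> 0 \<and> (\<exists>f\<in>set (G @ H). \<exists>\<eta> a. reduces_with lt H h f \<eta> a)"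

text \<open>
  The algorithm does not say which \<open>\<eta>\<close> to take if several are possible for the selected \<open>f\<close> and
  exponent of \<open>t\<close>; the choice is left unspecified.
\<close>

fun nf_step ::
    "('n mon \<Rightarrow> 'n mon \<Rightarrow> bool) \<Rightarrow> ('n::finite, 'k::field) tpol list \<Rightarrow>
      ('n, 'k) tpol \<times> ('n, 'k) tpol list \<Rightarrow> ('n, 'k) tpol \<times> ('n, 'k) tpol list"
  where "nf_step lt G (h, H) =
    (let a = (LEAST a. \<exists>f\<in>set (G @ H). \<exists>\<eta>. reduces_with lt H h f \<eta> a);
         f = the (find (\<lambda>f. \<exists>\<eta>. reduces_with lt H h f \<eta> a) (G @ H));
         \<eta> = (SOME \<eta>. reduces_with lt H h f \<eta> a)
     in (strip_t (txmon a 0 * h - \<eta> * f), if a > 0 then H @ [h] else H))"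

text \<open>The result is \<open>None\<close> if the loop does not terminate.\<close>

definition normal_form ::
    "('n mon \<Rightarrow> 'n mon \<Rightarrow> bool) \<Rightarrow> ('n::finite, 'k::field) tpol \<Rightarrow> ('n, 'k) tpol list \<Rightarrow>
      ('n, 'k) tpol option"
  where "normal_form lt p G =
    map_option fst (while_option (nf_continue lt G) (nf_step lt G) (p, []))"


section \<open>Reducing sets\<close>

text \<open>
  Leading monomials of products with \<open>f\<close> exist only for \<open>f \<noteq> 0\<close>, so the condition on them is
  imposed only in that case; it includes that the products \<open>\<xi> i * h i\<close> are nonzero. A
  nonterminating normal form computation contributes no element to the set of admissible \<open>h i\<close>.
\<close>

definition reducing_set ::
    "('n mon \<Rightarrow> 'n mon \<Rightarrow> bool) \<Rightarrow> ('n::finite, 'k::field) tpol \<Rightarrow> ('n, 'k) tpol list \<Rightarrow>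
      'n mon set \<Rightarrow> bool"
  where "reducing_set lt f G R \<longleftrightarrow> finite R \<and>
    (\<forall>\<alpha>. \<exists>g (k :: nat) \<xi> h.
      homogeneous g \<and> dehom g \<noteq> 0 \<and> LM lt (dehom g) = 0 \<and>
      (\<forall>i\<in>{1..k}. \<xi> i \<in> terms_t \<and>
        h i \<in> set G \<union> {q. \<exists>\<beta>\<in>R. normal_form lt (txmon 0 \<beta> * f) G = Some q}) \<and>
      g * txmon 0 \<alpha> * f = (\<Sum>i=1..k. \<xi> i * h i) \<and>
      (f \<noteq> 0 \<longrightarrow> 1 \<le> k \<and>
        \<xi> 1 * h 1 \<noteq> 0 \<and>
        LM (hom_less lt) (g * txmon 0 \<alpha> * f) = LM (hom_less lt) (\<xi> 1 * h 1) \<and>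
        (\<forall>i\<in>{2..k}. \<xi> i * h i \<noteq> 0 \<and>
          hom_less lt (LM (hom_less lt) (\<xi> i * h i)) (LM (hom_less lt) (\<xi> 1 * h 1)))))"

end

theory Submission
  imports Defs
begin

text \<open>
  Let \<open>f \<noteq> 0\<close>, fix \<open>\<alpha>\<close>, and put \<open>F = f|\<^sub>t\<^sub>=\<^sub>1\<close>. The leading monomial \<open>\<mu>\<close> of \<open>x\<^sup>\<alpha> F\<close> lies in some
  cone \<open>M\<^sub>\<delta>(l)\<close>, so it occurs in an \<open>R(l)\<close>-linear combination of the generators \<open>S\<^sub>l\<close>; comparing
  coefficients gives \<open>\<mu> = \<gamma> + \<sigma>\<close> with \<open>\<gamma> \<in> M(l)\<close> and \<open>\<sigma> \<in> S\<^sub>l\<close> (\<open>module_generator_divides\<close>). Let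
  \<open>b\<close> be the chosen exponent with leading monomial of \<open>x\<^sup>b F\<close> equal to \<open>\<sigma>\<close>. Three facts on
  Newton orderings turn this into the claim.

  First, a Newton ordering is in general not compatible with multiplication, but adding an
  element of \<open>M(l)\<close> preserves \<open>\<alpha>' \<prec> \<sigma>\<close> whenever \<open>\<sigma> \<in> M\<^sub>\<delta>(l)\<close>, because the weight is
  superadditive, and additive on the cone (\<open>cone_shift\<close>). Hence \<open>x\<^sup>\<gamma> x\<^sup>b F\<close> has leading monomial
  \<open>\<gamma> + \<sigma> = \<mu>\<close>, too.

  Second, different monomial multiples of \<open>F\<close> have different leading monomials
  (\<open>LM_xmon_mult_inj\<close>): the weight is concave, so \<open>\<mu> + v\<close> and \<open>\<mu> - v\<close> cannot both lie below \<open>\<mu>\<close>.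
  So \<open>\<alpha> = \<gamma> + b\<close>: every monomial multiple of \<open>f\<close> is a multiple, by a monomial from a suitable
  cone, of one of the finitely many polynomials \<open>x\<^sup>b f\<close> that are passed to the normal form
  algorithm.

  Third, the algorithm stops on \<open>x\<^sup>b f\<close>, and its run yields \<open>u x\<^sup>b f = \<xi>\<^sub>1 h\<^sub>1 + \<dots> + \<xi>\<^sub>k h\<^sub>k\<close>
  where \<open>u|\<^sub>t\<^sub>=\<^sub>1\<close> has leading monomial \<open>1\<close>, the \<open>h\<^sub>i\<close> lie in \<open>G\<close> or equal the normal form, and
  the first summand has a strictly larger leading monomial than all others
  (\<open>normal_form_headed_sum\<close>). Here normality is what keeps both \<open>u\<close> and the lower summands under
  control when an intermediate result is reduced by an earlier one. Multiplying this equation by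
  \<open>x\<^sup>\<gamma>\<close> preserves its shape by the first fact.

  Termination (\<open>normal_form_terminates\<close>) uses that the forms are rational. The cone \<open>M(l)\<close> is
  cut out by finitely many forms whose values on exponents are, after scaling, integers. By
  Dickson's lemma, an infinite sequence of stored intermediate results contains two members
  whose leading exponents differ by an element of \<open>M(l)\<close>, with a nonnegative difference of the
  exponents of \<open>t\<close>; the earlier one then reduces the later one without multiplying it by \<open>t\<close>, so
  the later one is not stored (\<open>decreasing_sequence_reduces\<close>). Once nothing is stored any more,
  degrees no longer grow, while the leading monomials at \<open>t = 1\<close> still decrease strictly; only
  finitely many monomials are left for them.
\<close>


section \<open>Monomial multiples\<close>

lemma lookup_single_mult:
  fixes p :: "'m::cancel_comm_monoid_add \<Rightarrow>\<^sub>0 'k::field"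
  shows "Poly_Mapping.lookup (Poly_Mapping.single m c * p) (m + x) = c * Poly_Mapping.lookup p x"
proof -
  have "(\<Sum>q. Poly_Mapping.lookup p q when m + x = m + q) = Poly_Mapping.lookup p x"
    by simp
  then show ?thesis
    by (simp add: lookup_mult lookup_single when_mult)
qed

lemma keys_single_mult:
  fixes p :: "'m::cancel_comm_monoid_add \<Rightarrow>\<^sub>0 'k::field"
  assumes "c \<noteq> 0"
  shows "Poly_Mapping.keys (Poly_Mapping.single m c * p) = (+) m ` Poly_Mapping.keys p"
proof
  show "Poly_Mapping.keys (Poly_Mapping.single m c * p) \<subseteq> (+) m ` Poly_Mapping.keys p"
    using keys_mult[of "Poly_Mapping.single m c" p] assms by auto
  show "(+) m ` Poly_Mapping.keys p \<subseteq> Poly_Mapping.keys (Poly_Mapping.single m c * p)"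
    using assms by (auto simp: in_keys_iff lookup_single_mult)
qed

lemma single_mult_eq_0_iff:
  fixes p :: "'m::cancel_comm_monoid_add \<Rightarrow>\<^sub>0 'k::field"
  assumes "c \<noteq> 0"
  shows "Poly_Mapping.single m c * p = 0 \<longleftrightarrow> p = 0"
  using keys_single_mult[OF assms, of m p] by (metis image_is_empty keys_eq_empty mult_zero_right)

lemma keys_minus_subset:
  fixes p q :: "'m \<Rightarrow>\<^sub>0 'k::ab_group_add"
  shows "Poly_Mapping.keys (p - q) \<subseteq> Poly_Mapping.keys p \<union> Poly_Mapping.keys q"
  by (auto simp: in_keys_iff lookup_minus)

lemma keys_kspan:
  assumes "q \<in> kspan (xmon ` A)"
  shows "Poly_Mapping.keys (q :: ('n, 'k::field) pol) \<subseteq> A"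
proof -
  interpret module "\<lambda>c (p :: ('n, 'k) pol). Poly_Mapping.single 0 c * p"
    by (rule module_scale)
  let ?V = "{p :: ('n, 'k) pol. Poly_Mapping.keys p \<subseteq> A}"
  have "subspace ?V"
  proof (rule subspaceI)
    show "p + p' \<in> ?V" if "p \<in> ?V" "p' \<in> ?V" for p p'
      using that keys_add[of p p'] by auto
    show "Poly_Mapping.single 0 c * p \<in> ?V" if "p \<in> ?V" for c p
      using that keys_single_mult[of c 0 p] by (cases "c = 0") auto
  qed simp
  moreover have "xmon ` A \<subseteq> ?V"
    by (auto simp: xmon_def split: if_splits)
  ultimately have "span (xmon ` A) \<subseteq> ?V"
    by (rule span_minimal[rotated])
  then show ?thesis
    using assms by (auto simp: kspan_def)
qed

lemma xmon_in_kspan: "\<alpha> \<in> A \<Longrightarrow> xmon \<alpha> \<in> kspan (xmon ` A)"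
  using module.span_base[OF module_scale] unfolding kspan_def by blast

lemma zero_in_kspan: "0 \<in> kspan B"
  using module.span_zero[OF module_scale] unfolding kspan_def by blast

lemma tdeg_add: "tdeg (m + m') = tdeg m + tdeg m'"
  by (simp add: tdeg_def lookup_add sum.distrib)

lemma tdeg_zero_right [simp]: "tdeg (a, 0) = a"
  by (simp add: tdeg_def)

lemma tmon_eqI: "tdeg m = tdeg m' \<Longrightarrow> snd m = snd m' \<Longrightarrow> m = m'"
  by (simp add: tdeg_def prod_eq_iff)

lemma txmon_mult: "txmon a \<alpha> * txmon b \<beta> = txmon (a + b) (\<alpha> + \<beta>)"
  by (simp add: txmon_def mult_single)

lemma txmon_zero [simp]: "txmon 0 0 = 1"
  by (simp add: txmon_def flip: zero_prod_def)

lemma txmon_in_terms: "txmon a \<alpha> \<in> terms_t"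
  unfolding terms_t_def txmon_def using one_neq_zero by (metis (mono_tags, lifting) mem_Collect_eq)

lemma terms_mult: "\<xi> \<in> terms_t \<Longrightarrow> \<eta> \<in> terms_t \<Longrightarrow> \<xi> * \<eta> \<in> terms_t"
proof -
  assume "\<xi> \<in> terms_t" "\<eta> \<in> terms_t"
  then obtain m c m' c' where "\<xi> = Poly_Mapping.single m c" "c \<noteq> 0"
    "\<eta> = Poly_Mapping.single m' c'" "c' \<noteq> 0"
    unfolding terms_t_def by blast
  then have "\<xi> * \<eta> = Poly_Mapping.single (m + m') (c * c')" "c * c' \<noteq> 0"
    by (simp_all add: mult_single)
  then show ?thesis
    unfolding terms_t_def by blast
qed

text \<open>
  The exponent of \<open>t\<close> in any monomial of \<open>h\<close> bounds the powers of \<open>t\<close> that divide \<open>h\<close>, so the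
  greatest one exists, and the quotient is unique since multiplication by a monomial is
  injective.
\<close>

lemma strip_t_factor:
  assumes "h \<noteq> 0"
  obtains e where "h = txmon e 0 * strip_t (h :: ('n::finite, 'k::field) tpol)"
proof -
  from assms have "Poly_Mapping.keys h \<noteq> {}" by simp
  then obtain m where m: "m \<in> Poly_Mapping.keys h" by blast
  define e where "e = (GREATEST k. txmon k 0 dvd h)"
  have bound: "k \<le> fst m" if "txmon k 0 dvd h" for k
  proof -
    from that obtain q where "h = txmon k 0 * q" by (rule dvdE)
    then have "m \<in> (+) (k, 0) ` Poly_Mapping.keys q"
      using m by (simp add: txmon_def keys_single_mult)
    then show ?thesis by auto
  qed
  have "txmon 0 0 dvd h" by simp
  then have "txmon e 0 dvd h"
    unfolding e_def using bound by (rule GreatestI_nat)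
  then obtain q where q: "h = txmon e 0 * q" by (rule dvdE)
  have "(THE q. h = txmon e 0 * q) = q"
  proof (rule the_equality)
    fix q' assume "h = txmon e 0 * q'"
    then have "txmon e 0 * q' = txmon e 0 * q" using q by (rule trans[OF sym])
    then have "Poly_Mapping.single (e, 0) 1 * (q' - q) = 0"
      by (simp only: txmon_def right_diff_distrib diff_self)
    then have "q' - q = 0"
      by (rule single_mult_eq_0_iff[OF one_neq_zero, THEN iffD1])
    then show "q' = q" by simp
  qed (fact q)
  then have "strip_t h = q"
    using assms by (simp add: strip_t_def e_def)
  with q have "h = txmon e 0 * strip_t h" by simp
  then show ?thesis ..
qed

lemma strip_t_zero [simp]: "strip_t 0 = 0"
  by (simp add: strip_t_def)


section \<open>Leading monomials of homogeneous polynomials\<close>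

lemma finite_total_ordering_max:
  assumes "total_ordering lt" "finite A" "A \<noteq> {}"
  shows "\<exists>m\<in>A. \<forall>m'\<in>A. m' \<noteq> m \<longrightarrow> lt m' m"
  using assms(2,3)
proof (induction rule: finite_ne_induct)
  case (insert x F)
  then obtain m where m: "m \<in> F" "\<forall>m'\<in>F. m' \<noteq> m \<longrightarrow> lt m' m" by blast
  have tr: "lt a c" if "lt a b" "lt b c" for a b c
    using assms(1) that unfolding total_ordering_def by (blast dest: transpD)
  have "lt x m \<or> x = m \<or> lt m x"
    using assms(1) unfolding total_ordering_def totalp_on_def by blast
  then show ?case
  proof (elim disjE)
    assume "lt m x"
    then have "\<forall>m'\<in>F. lt m' x"
      using m tr by metis
    then show ?thesis by blast
  qed (use m in auto)
qed simp

lemma LM_eqI: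
  assumes "total_ordering lt" "m \<in> Poly_Mapping.keys f"
    and "\<And>m'. m' \<in> Poly_Mapping.keys f \<Longrightarrow> m' \<noteq> m \<Longrightarrow> lt m' m"
  shows "LM lt f = m"
  unfolding LM_def
proof (rule the_equality)
  fix n assume "n \<in> Poly_Mapping.keys f \<and> (\<forall>m'\<in>Poly_Mapping.keys f. m' \<noteq> n \<longrightarrow> lt m' n)"
  then show "n = m"
    using assms unfolding total_ordering_def by (metis irreflpD transpD)
qed (use assms in blast)

lemma
  assumes "total_ordering lt" "f \<noteq> 0"
  shows LM_in_keys: "LM lt f \<in> Poly_Mapping.keys f"
    and LM_greatest: "m \<in> Poly_Mapping.keys f \<Longrightarrow> m \<noteq> LM lt f \<Longrightarrow> lt m (LM lt f)"
proof -
  from finite_total_ordering_max[OF assms(1), of "Poly_Mapping.keys f"] assms(2)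
  obtain n where n: "n \<in> Poly_Mapping.keys f" "\<forall>m'\<in>Poly_Mapping.keys f. m' \<noteq> n \<longrightarrow> lt m' n"
    by auto
  then have "LM lt f = n"
    using LM_eqI[OF assms(1)] by blast
  with n show "LM lt f \<in> Poly_Mapping.keys f"
    and "m \<in> Poly_Mapping.keys f \<Longrightarrow> m \<noteq> LM lt f \<Longrightarrow> lt m (LM lt f)" by auto
qed

lemma LM_single: "total_ordering lt \<Longrightarrow> c \<noteq> 0 \<Longrightarrow> LM lt (Poly_Mapping.single m c) = m"
  by (rule LM_eqI) auto

lemma LT_eqD:
  assumes "total_ordering lt" "f \<noteq> 0" "g \<noteq> 0" "LT lt f = LT lt g"
  shows "LM lt f = LM lt g"
    and "Poly_Mapping.lookup f (LM lt f) = Poly_Mapping.lookup g (LM lt g)"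
proof -
  have "Poly_Mapping.lookup f (LM lt f) \<noteq> 0" "Poly_Mapping.lookup g (LM lt g) \<noteq> 0"
    using LM_in_keys assms by (auto simp: in_keys_iff)
  moreover from assms(4) have
    "Poly_Mapping.lookup (LT lt f) (LM lt f) = Poly_Mapping.lookup (LT lt g) (LM lt f)" by simp
  ultimately show "LM lt f = LM lt g"
    unfolding LT_def by (metis lookup_single_eq lookup_single_not_eq)
  with assms(4) show "Poly_Mapping.lookup f (LM lt f) = Poly_Mapping.lookup g (LM lt g)"
    unfolding LT_def by (metis lookup_single_eq)
qed

definition hom_of_degree :: "nat \<Rightarrow> ('n::finite, 'k::field) tpol \<Rightarrow> bool"
  where "hom_of_degree d p \<longleftrightarrow> (\<forall>m\<in>Poly_Mapping.keys p. tdeg m = d)"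

lemma homogeneous_iff: "homogeneous p \<longleftrightarrow> (\<exists>d. hom_of_degree d p)"
  by (simp add: homogeneous_def hom_of_degree_def)

lemma hom_of_degree_single_mult:
  "hom_of_degree d p \<Longrightarrow> hom_of_degree (tdeg m + d) (Poly_Mapping.single m c * p)"
  by (cases "c = 0") (auto simp: hom_of_degree_def keys_single_mult tdeg_add)

lemma hom_of_degree_txmon_cancel:
  "hom_of_degree d (txmon a 0 * p) \<Longrightarrow> hom_of_degree (d - a) p"
  by (force simp: hom_of_degree_def txmon_def keys_single_mult tdeg_add)

lemma hom_of_degree_unique:
  "hom_of_degree d p \<Longrightarrow> hom_of_degree d' p \<Longrightarrow> p \<noteq> 0 \<Longrightarrow> d = d'"
  unfolding hom_of_degree_def by (metis all_not_in_conv keys_eq_empty)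

text \<open>
  The degree of a monomial recovers its exponent of \<open>t\<close> from the remaining exponents, so setting
  \<open>t = 1\<close> merges no two monomials of a homogeneous polynomial.
\<close>

lemma keys_dehom:
  assumes "hom_of_degree d p"
  shows "Poly_Mapping.keys (dehom p) = snd ` Poly_Mapping.keys p"
proof (intro set_eqI)
  fix x
  have lk: "Poly_Mapping.lookup (dehom p) x =
      (\<Sum>m\<in>Poly_Mapping.keys p. Poly_Mapping.lookup p m when snd m = x)"
    by (simp add: dehom_def lookup_sum lookup_single)
  show "x \<in> Poly_Mapping.keys (dehom p) \<longleftrightarrow> x \<in> snd ` Poly_Mapping.keys p"
  proof (cases "x \<in> snd ` Poly_Mapping.keys p")
    case True
    then obtain m0 where m0: "m0 \<in> Poly_Mapping.keys p" "snd m0 = x" by auto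
    have "snd m = x \<longleftrightarrow> m = m0" if "m \<in> Poly_Mapping.keys p" for m
      using that m0 assms tmon_eqI[of m m0] by (auto simp: hom_of_degree_def)
    then have "Poly_Mapping.lookup (dehom p) x =
        (\<Sum>m\<in>Poly_Mapping.keys p. Poly_Mapping.lookup p m when m = m0)"
      unfolding lk by (intro sum.cong) auto
    also have "\<dots> = Poly_Mapping.lookup p m0"
      using m0 by (simp add: when_def)
    finally show ?thesis
      using True m0 by (simp add: in_keys_iff)
  next
    case False
    then have "Poly_Mapping.lookup (dehom p) x = 0"
      unfolding lk by (intro sum.neutral) (force simp: when_def)
    with False show ?thesis by (simp add: in_keys_iff)
  qed
qed


section \<open>Bounds on all monomials of a polynomial\<close>

locale total_mon_order =
  fixes lt :: "'n::finite mon \<Rightarrow> 'n mon \<Rightarrow> bool"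
  assumes total: "total_ordering lt"
begin

lemma lt_irrefl: "\<not> lt \<alpha> \<alpha>"
  using total unfolding total_ordering_def by (blast dest: irreflpD)

lemma lt_trans: "lt \<alpha> \<beta> \<Longrightarrow> lt \<beta> \<gamma> \<Longrightarrow> lt \<alpha> \<gamma>"
  using total unfolding total_ordering_def by (blast dest: transpD)

lemma lt_total: "\<alpha> = \<beta> \<or> lt \<alpha> \<beta> \<or> lt \<beta> \<alpha>"
  using total unfolding total_ordering_def totalp_on_def by blast

lemma total_hom_less: "total_ordering (hom_less lt)"
  unfolding total_ordering_def
proof (intro conjI irreflpI transpI totalpI)
  fix m m' :: "'n tmon" assume "m \<noteq> m'"
  then show "hom_less lt m m' \<or> hom_less lt m' m"
    using lt_total[of "snd m" "snd m'"] tmon_eqI[of m m'] unfolding hom_less_def by linarith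
next
  fix m1 m2 m3 :: "'n tmon" assume "hom_less lt m1 m2" "hom_less lt m2 m3"
  then show "hom_less lt m1 m3"
    using lt_trans[of "snd m1" "snd m2" "snd m3"] unfolding hom_less_def by linarith
qed (simp add: hom_less_def lt_irrefl)

text \<open>
  In a fixed degree, the order on \<open>K[t,x]\<close> compares only the exponents of \<open>x\<close>. The two
  predicates therefore record a degree together with the leading exponent \<open>\<sigma>\<close> at \<open>t = 1\<close>, or a
  strict upper bound for it. They speak of all monomials and not of the leading one alone, since
  \<open>lt\<close> need not be compatible with multiplication: bounds on all monomials can be shifted one by
  one. The zero polynomial is below every \<open>\<sigma>\<close>.
\<close>

definition headed :: "nat \<Rightarrow> 'n mon \<Rightarrow> ('n, 'k::field) tpol \<Rightarrow> bool"
  where "headed d \<sigma> p \<longleftrightarrow> \<sigma> \<in> snd ` Poly_Mapping.keys p \<and>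
    (\<forall>m\<in>Poly_Mapping.keys p. tdeg m = d \<and> (snd m = \<sigma> \<or> lt (snd m) \<sigma>))"

definition below :: "nat \<Rightarrow> 'n mon \<Rightarrow> ('n, 'k::field) tpol \<Rightarrow> bool"
  where "below d \<sigma> p \<longleftrightarrow> (\<forall>m\<in>Poly_Mapping.keys p. tdeg m = d \<and> lt (snd m) \<sigma>)"

lemma headed_nonzero: "headed d \<sigma> p \<Longrightarrow> p \<noteq> 0"
  by (auto simp: headed_def)

lemma headed_hom: "headed d \<sigma> p \<Longrightarrow> hom_of_degree d p"
  by (simp add: headed_def hom_of_degree_def)

lemma below_hom: "below d \<sigma> p \<Longrightarrow> hom_of_degree d p"
  by (simp add: below_def hom_of_degree_def)

lemma LM_headed:
  assumes "headed d \<sigma> p"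
  shows "tdeg (LM (hom_less lt) p) = d" "snd (LM (hom_less lt) p) = \<sigma>"
proof -
  from assms obtain m where m: "m \<in> Poly_Mapping.keys p" "snd m = \<sigma>" "tdeg m = d"
    unfolding headed_def by blast
  have "LM (hom_less lt) p = m"
  proof (rule LM_eqI[OF total_hom_less m(1)])
    fix m' assume "m' \<in> Poly_Mapping.keys p" "m' \<noteq> m"
    then show "hom_less lt m' m"
      using assms m tmon_eqI[of m' m] by (auto simp: headed_def hom_less_def)
  qed
  with m show "tdeg (LM (hom_less lt) p) = d" "snd (LM (hom_less lt) p) = \<sigma>" by simp_all
qed

lemma headed_LM:
  assumes "hom_of_degree d p" "p \<noteq> 0"
  shows "headed d (snd (LM (hom_less lt) p)) p"
proof -
  let ?m = "LM (hom_less lt) p"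
  have in_keys: "?m \<in> Poly_Mapping.keys p"
    by (rule LM_in_keys[OF total_hom_less assms(2)])
  have "snd m = snd ?m \<or> lt (snd m) (snd ?m)" if "m \<in> Poly_Mapping.keys p" for m
  proof (cases "m = ?m")
    case False
    then have "hom_less lt m ?m"
      by (rule LM_greatest[OF total_hom_less assms(2) that])
    moreover have "tdeg m = tdeg ?m"
      using that in_keys assms(1) by (simp add: hom_of_degree_def)
    ultimately show ?thesis
      by (simp add: hom_less_def[of lt m ?m])
  qed simp
  with in_keys assms(1) show ?thesis
    unfolding headed_def hom_of_degree_def by blast
qed

lemma headed_dehom:
  assumes "headed d \<sigma> p"
  shows "LM lt (dehom p) = \<sigma>" "dehom p \<noteq> 0"
proof -
  have keys: "Poly_Mapping.keys (dehom p) = snd ` Poly_Mapping.keys p"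
    by (rule keys_dehom[OF headed_hom[OF assms]])
  show "LM lt (dehom p) = \<sigma>"
    using assms by (intro LM_eqI[OF total]) (auto simp: keys headed_def)
  show "dehom p \<noteq> 0"
    using keys headed_nonzero[OF assms] by auto
qed

lemma LM_below_headed:
  assumes "below d \<sigma> q" "q \<noteq> 0" "headed d \<sigma> p"
  shows "hom_less lt (LM (hom_less lt) q) (LM (hom_less lt) p)"
  using LM_in_keys[OF total_hom_less assms(2)] assms(1) LM_headed[OF assms(3)]
  by (simp add: below_def hom_less_def)

lemma below_zero [simp]: "below d \<sigma> 0"
  by (simp add: below_def)

lemma below_add: "below d \<sigma> p \<Longrightarrow> below d \<sigma> q \<Longrightarrow> below d \<sigma> (p + q)"
  using keys_add[of p q] unfolding below_def by blast

lemma headed_add_below: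
  assumes "headed d \<sigma> p" "below d \<sigma> q"
  shows "headed d \<sigma> (p + q)"
proof -
  from assms(1) obtain m where m: "m \<in> Poly_Mapping.keys p" "snd m = \<sigma>"
    unfolding headed_def by blast
  have "m \<notin> Poly_Mapping.keys q"
    using assms(2) m lt_irrefl unfolding below_def by blast
  with m have "m \<in> Poly_Mapping.keys (p + q)"
    by (simp add: in_keys_iff lookup_add)
  with m(2) have "\<sigma> \<in> snd ` Poly_Mapping.keys (p + q)" by blast
  then show ?thesis
    using assms keys_add[of p q] unfolding headed_def below_def by blast
qed

lemma below_single_mult:
  assumes "below d \<sigma> p" "\<And>\<alpha>. lt \<alpha> \<sigma> \<Longrightarrow> lt (\<gamma> + \<alpha>) (\<gamma> + \<sigma>)"
  shows "below (tdeg (a, \<gamma>) + d) (\<gamma> + \<sigma>) (Poly_Mapping.single (a, \<gamma>) c * p)"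
  using assms by (cases "c = 0") (auto simp: below_def keys_single_mult tdeg_add)

lemma headed_single_mult:
  assumes "headed d \<sigma> p" "c \<noteq> 0" "\<And>\<alpha>. lt \<alpha> \<sigma> \<Longrightarrow> lt (\<gamma> + \<alpha>) (\<gamma> + \<sigma>)"
  shows "headed (tdeg (a, \<gamma>) + d) (\<gamma> + \<sigma>) (Poly_Mapping.single (a, \<gamma>) c * p)"
  using assms by (auto simp: headed_def keys_single_mult tdeg_add image_image)

lemma below_txmon_mult: "below d \<sigma> p \<Longrightarrow> below (a + d) \<sigma> (txmon a 0 * p)"
  using below_single_mult[of d \<sigma> p 0] by (simp add: txmon_def)

lemma headed_txmon_mult: "headed d \<sigma> p \<Longrightarrow> headed (a + d) \<sigma> (txmon a 0 * p)"
  using headed_single_mult[of d \<sigma> p 1 0] by (simp add: txmon_def)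

text \<open>
  Equal leading terms force equal degrees, and in one degree only a single monomial has the
  \<open>x\<close>-exponent \<open>\<sigma>\<close>; its two coefficients cancel.
\<close>

lemma cancel_leading_term:
  fixes p q :: "('n, 'k::field) tpol"
  assumes LT: "LT (hom_less lt) q = LT (hom_less lt) p" and "q \<noteq> 0"
    and hom: "hom_of_degree d q" and head: "headed d' \<sigma> p"
  shows "headed d' \<sigma> q" "below d' \<sigma> (p - q)"
proof -
  let ?T = "hom_less lt"
  have "p \<noteq> 0" using headed_nonzero[OF head] .
  note eq = LT_eqD[OF total_hom_less \<open>q \<noteq> 0\<close> this LT]
  have "headed d (snd (LM ?T q)) q"
    by (rule headed_LM[OF hom \<open>q \<noteq> 0\<close>])
  moreover from LM_headed[OF this] LM_headed[OF head] eq(1) have "d = d'" by simp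
  ultimately show headq: "headed d' \<sigma> q"
    using LM_headed[OF head] eq(1) by simp
  show "below d' \<sigma> (p - q)"
    unfolding below_def
  proof
    fix m assume m: "m \<in> Poly_Mapping.keys (p - q)"
    then have deg: "tdeg m = d'" and "snd m = \<sigma> \<or> lt (snd m) \<sigma>"
      using keys_minus_subset[of p q] head headq unfolding headed_def by blast+
    moreover have "snd m \<noteq> \<sigma>"
    proof
      assume "snd m = \<sigma>"
      then have "m = LM ?T p"
        using LM_headed[OF head] deg tmon_eqI by metis
      then show False
        using m eq by (simp add: in_keys_iff lookup_minus)
    qed
    ultimately show "tdeg m = d' \<and> lt (snd m) \<sigma>" by blast
  qed
qed

text \<open>
  These sets describe the right-hand sides that reducing sets ask for: one summand with leading
  exponent \<open>\<sigma>\<close>, accompanied by summands that lie strictly below \<open>\<sigma>\<close> one by one, so that no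
  cancellation among them is involved.
\<close>

definition lower_sums ::
    "('n, 'k::field) tpol set \<Rightarrow> nat \<Rightarrow> 'n mon \<Rightarrow> ('n, 'k) tpol set"
  where "lower_sums A d \<sigma> = {\<Sum>(\<xi>, h)\<leftarrow>xs. \<xi> * h | xs. \<forall>(\<xi>, h)\<in>set xs.
    \<xi> \<in> terms_t \<and> h \<in> A \<and> \<xi> * h \<noteq> 0 \<and> below d \<sigma> (\<xi> * h)}"

definition headed_sums ::
    "('n, 'k::field) tpol set \<Rightarrow> nat \<Rightarrow> 'n mon \<Rightarrow> ('n, 'k) tpol set"
  where "headed_sums A d \<sigma> = {\<xi> * h + r | \<xi> h r.
    \<xi> \<in> terms_t \<and> h \<in> A \<and> headed d \<sigma> (\<xi> * h) \<and> r \<in> lower_sums A d \<sigma>}"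

lemma zero_in_lower_sums: "0 \<in> lower_sums A d \<sigma>"
  unfolding lower_sums_def by (intro CollectI exI[of _ "[]"]) simp

lemma summand_in_lower_sums:
  assumes "\<xi> \<in> terms_t" "h \<in> A" "below d \<sigma> (\<xi> * h)"
  shows "\<xi> * h \<in> lower_sums A d \<sigma>"
proof (cases "\<xi> * h = 0")
  case False
  with assms show ?thesis
    unfolding lower_sums_def by (intro CollectI exI[of _ "[(\<xi>, h)]"]) simp
qed (simp add: zero_in_lower_sums)

lemma lower_sums_add:
  assumes "p \<in> lower_sums A d \<sigma>" "q \<in> lower_sums A d \<sigma>"
  shows "p + q \<in> lower_sums A d \<sigma>"
proof -
  let ?good = "\<lambda>xs. \<forall>(\<xi>, h)\<in>set xs.
    \<xi> \<in> terms_t \<and> h \<in> A \<and> \<xi> * h \<noteq> 0 \<and> below d \<sigma> (\<xi> * h)"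
  from assms obtain xs ys where
    "p = (\<Sum>(\<xi>, h)\<leftarrow>xs. \<xi> * h)" "?good xs" "q = (\<Sum>(\<xi>, h)\<leftarrow>ys. \<xi> * h)" "?good ys"
    unfolding lower_sums_def by blast
  then show ?thesis
    unfolding lower_sums_def by (intro CollectI exI[of _ "xs @ ys"]) auto
qed

lemma lower_sums_mono: "A \<subseteq> B \<Longrightarrow> lower_sums A d \<sigma> \<subseteq> lower_sums B d \<sigma>"
  unfolding lower_sums_def by fastforce

lemma headed_sums_mono: "A \<subseteq> B \<Longrightarrow> headed_sums A d \<sigma> \<subseteq> headed_sums B d \<sigma>"
  unfolding headed_sums_def using lower_sums_mono[of A B d \<sigma>] by blast

lemma headed_sums_add_lower:
  assumes "p \<in> headed_sums A d \<sigma>" "q \<in> lower_sums A d \<sigma>"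
  shows "p + q \<in> headed_sums A d \<sigma>"
proof -
  from assms(1) obtain \<xi> h r where "p = \<xi> * h + r" "\<xi> \<in> terms_t" "h \<in> A" "headed d \<sigma> (\<xi> * h)"
    "r \<in> lower_sums A d \<sigma>" unfolding headed_sums_def by blast
  moreover from this(5) assms(2) have "r + q \<in> lower_sums A d \<sigma>"
    by (rule lower_sums_add)
  ultimately show ?thesis
    unfolding headed_sums_def using add.assoc by blast
qed

text \<open>
  Monomials do not respect the ordering in general, so the effect of the factor on single
  polynomials is a hypothesis here and in the next two lemmas. It holds for powers of \<open>t\<close>, for
  monomials below \<open>1\<close> (where a leading summand becomes a lower one), and for Newton orderings
  also for monomials from a common cone.
\<close>

lemma lower_sums_single_mult:
  fixes A :: "('n, 'k::field) tpol set"
  assumes "q \<in> lower_sums A d \<sigma>" "c \<noteq> 0"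
    and mult: "\<And>p :: ('n, 'k) tpol. below d \<sigma> p \<Longrightarrow> below d' \<sigma>' (Poly_Mapping.single m c * p)"
  shows "Poly_Mapping.single m c * q \<in> lower_sums A d' \<sigma>'"
proof -
  from assms(1) obtain xs where q: "q = (\<Sum>(\<xi>, h)\<leftarrow>xs. \<xi> * h)" and xs: "\<forall>(\<xi>, h)\<in>set xs.
    \<xi> \<in> terms_t \<and> h \<in> A \<and> \<xi> * h \<noteq> 0 \<and> below d \<sigma> (\<xi> * h)"
    unfolding lower_sums_def by blast
  have is_term: "Poly_Mapping.single m c \<in> terms_t"
    using \<open>c \<noteq> 0\<close> unfolding terms_t_def by blast
  from xs show ?thesis
    unfolding q
  proof (induction xs)
    case (Cons x xs)
    obtain \<xi> h where x: "x = (\<xi>, h)" by (cases x)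
    with Cons.prems have "\<xi> \<in> terms_t" "h \<in> A" "below d \<sigma> (\<xi> * h)" by auto
    then have "(Poly_Mapping.single m c * \<xi>) * h \<in> lower_sums A d' \<sigma>'"
      using is_term terms_mult mult[of "\<xi> * h"]
      by (intro summand_in_lower_sums) (auto simp: mult.assoc)
    then show ?case
      using Cons x lower_sums_add by (auto simp: distrib_left mult.assoc)
  qed (simp add: zero_in_lower_sums)
qed

lemma headed_sums_single_mult:
  fixes A :: "('n, 'k::field) tpol set"
  assumes "q \<in> headed_sums A d \<sigma>" "c \<noteq> 0"
    and "\<And>p :: ('n, 'k) tpol. below d \<sigma> p \<Longrightarrow> below d' \<sigma>' (Poly_Mapping.single m c * p)"
    and "\<And>p :: ('n, 'k) tpol. headed d \<sigma> p \<Longrightarrow> headed d' \<sigma>' (Poly_Mapping.single m c * p)"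
  shows "Poly_Mapping.single m c * q \<in> headed_sums A d' \<sigma>'"
proof -
  from assms(1) obtain \<xi> h r where q: "q = \<xi> * h + r" "\<xi> \<in> terms_t" "h \<in> A" "headed d \<sigma> (\<xi> * h)"
    and r: "r \<in> lower_sums A d \<sigma>" unfolding headed_sums_def by blast
  have "Poly_Mapping.single m c * q =
      (Poly_Mapping.single m c * \<xi>) * h + Poly_Mapping.single m c * r"
    by (simp add: q(1) distrib_left mult.assoc)
  moreover have "Poly_Mapping.single m c * \<xi> \<in> terms_t"
    using \<open>c \<noteq> 0\<close> q(2) terms_mult unfolding terms_t_def by blast
  moreover have "headed d' \<sigma>' ((Poly_Mapping.single m c * \<xi>) * h)"
    using assms(4)[OF q(4)] by (simp add: mult.assoc)
  moreover have "Poly_Mapping.single m c * r \<in> lower_sums A d' \<sigma>'"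
    by (rule lower_sums_single_mult[OF r assms(2,3)])
  ultimately show ?thesis
    using q(3) unfolding headed_sums_def by blast
qed

lemma headed_sums_single_mult_lower:
  fixes A :: "('n, 'k::field) tpol set"
  assumes "q \<in> headed_sums A d \<sigma>" "c \<noteq> 0"
    and "\<And>p :: ('n, 'k) tpol. below d \<sigma> p \<Longrightarrow> below d' \<sigma>' (Poly_Mapping.single m c * p)"
    and "\<And>p :: ('n, 'k) tpol. headed d \<sigma> p \<Longrightarrow> below d' \<sigma>' (Poly_Mapping.single m c * p)"
  shows "Poly_Mapping.single m c * q \<in> lower_sums A d' \<sigma>'"
proof -
  from assms(1) obtain \<xi> h r where q: "q = \<xi> * h + r" "\<xi> \<in> terms_t" "h \<in> A" "headed d \<sigma> (\<xi> * h)"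
    and r: "r \<in> lower_sums A d \<sigma>" unfolding headed_sums_def by blast
  have "(Poly_Mapping.single m c * \<xi>) * h \<in> lower_sums A d' \<sigma>'"
  proof (rule summand_in_lower_sums[OF _ q(3)])
    show "Poly_Mapping.single m c * \<xi> \<in> terms_t"
      using \<open>c \<noteq> 0\<close> q(2) terms_mult unfolding terms_t_def by blast
    show "below d' \<sigma>' ((Poly_Mapping.single m c * \<xi>) * h)"
      using assms(4)[OF q(4)] by (simp add: mult.assoc)
  qed
  moreover have "Poly_Mapping.single m c * r \<in> lower_sums A d' \<sigma>'"
    by (rule lower_sums_single_mult[OF r assms(2,3)])
  ultimately show ?thesis
    unfolding q(1) using lower_sums_add by (auto simp: distrib_left mult.assoc)
qed

lemma headed_sums_txmon_mult:
  "q \<in> headed_sums A d \<sigma> \<Longrightarrow> txmon a 0 * q \<in> headed_sums A (a + d) \<sigma>"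
  unfolding txmon_def
  by (rule headed_sums_single_mult)
    (use below_txmon_mult headed_txmon_mult in \<open>auto simp: txmon_def\<close>)

end


locale normal_mon_order = total_mon_order lt
  for lt :: "'n::finite mon \<Rightarrow> 'n mon \<Rightarrow> bool" +
  fixes K :: "'k::field itself"
  assumes normal: "normal_ordering K lt"
begin

text \<open>
  Normality bounds the leading monomial of a multiple, hence all of its monomials, by the
  leading monomial of the polynomial itself.
\<close>

lemma normal_headed:
  assumes "headed d \<sigma> (p :: ('n, 'k) tpol)" "lt \<nu> 0"
  shows "below (tdeg (a, \<nu>) + d) \<sigma> (Poly_Mapping.single (a, \<nu>) c * p)"
proof (cases "c = 0")
  case False
  let ?P = "dehom p"
  have P: "?P \<noteq> 0" "LM lt ?P = \<sigma>"
    using headed_dehom[OF assms(1)] by auto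
  then have "lt (LM lt (xmon \<nu> * ?P)) \<sigma>"
    using normal assms(2) unfolding normal_ordering_def by blast
  moreover have "xmon \<nu> * ?P \<noteq> 0"
    using P by (simp add: xmon_def single_mult_eq_0_iff)
  ultimately have "lt \<alpha> \<sigma>" if "\<alpha> \<in> Poly_Mapping.keys (xmon \<nu> * ?P)" for \<alpha>
    using LM_greatest[OF total _ that] lt_trans by (cases "\<alpha> = LM lt (xmon \<nu> * ?P)") blast+
  moreover have "Poly_Mapping.keys (xmon \<nu> * ?P) = (\<lambda>m. \<nu> + snd m) ` Poly_Mapping.keys p"
    by (simp add: xmon_def keys_single_mult keys_dehom[OF headed_hom[OF assms(1)]] image_image)
  ultimately have "lt (\<nu> + snd m) \<sigma>" if "m \<in> Poly_Mapping.keys p" for m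
    using that by blast
  then show ?thesis
    using False assms(1) by (auto simp: below_def headed_def keys_single_mult tdeg_add)
qed simp

lemma normal_below:
  assumes "below d \<sigma> (p :: ('n, 'k) tpol)" "lt \<nu> 0"
  shows "below (tdeg (a, \<nu>) + d) \<sigma> (Poly_Mapping.single (a, \<nu>) c * p)"
proof (cases "p = 0")
  case False
  let ?\<tau> = "snd (LM (hom_less lt) p)"
  have "lt ?\<tau> \<sigma>"
    using LM_in_keys[OF total_hom_less False] assms(1) unfolding below_def by blast
  then show ?thesis
    using normal_headed[OF headed_LM[OF below_hom[OF assms(1)] False] assms(2), of a c] lt_trans
    unfolding below_def by blast
qed simp

end


section \<open>Divisions computed by the normal form algorithm\<close>

lemma dehom_single: "dehom (Poly_Mapping.single m c) = Poly_Mapping.single (snd m) c"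
  by (simp add: dehom_def)

lemma terms_nonzero: "\<eta> \<in> terms_t \<Longrightarrow> f \<noteq> 0 \<Longrightarrow> \<eta> * f \<noteq> 0"
  unfolding terms_t_def by (auto simp: single_mult_eq_0_iff)

lemma homogeneous_term_mult:
  assumes "homogeneous f" "\<eta> \<in> terms_t"
  obtains d where "hom_of_degree d (\<eta> * f)"
proof -
  from assms obtain d m c where "hom_of_degree d f" "\<eta> = Poly_Mapping.single m c"
    unfolding homogeneous_iff terms_t_def by blast
  then show thesis
    using that hom_of_degree_single_mult by blast
qed

text \<open>
  This isolates what the analysis needs from a step: the exponent of \<open>t\<close> is minimal, and some
  reduction realises it. Every possible selection among the admissible reductions has these
  properties. The factor \<open>txmon e 0\<close> is the power of \<open>t\<close> divided out.
\<close>

lemma nf_step_cases: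
  assumes "nf_continue lt G (h, H)"
  obtains f \<eta> a e h' where "f \<in> set (G @ H)" "reduces_with lt H h f \<eta> a"
    and "\<And>f' \<eta>' b. f' \<in> set (G @ H) \<Longrightarrow> reduces_with lt H h f' \<eta>' b \<Longrightarrow> a \<le> b"
    and "txmon a 0 * h - \<eta> * f = txmon e 0 * h'"
    and "nf_step lt G (h, H) = (h', if a > 0 then H @ [h] else H)"
proof -
  define P where "P a f \<longleftrightarrow> (\<exists>\<eta>. reduces_with lt H h f \<eta> a)" for a f
  have P_fun: "P = (\<lambda>a f. \<exists>\<eta>. reduces_with lt H h f \<eta> a)"
    by (simp add: P_def fun_eq_iff)
  define a where "a = (LEAST a. \<exists>f\<in>set (G @ H). P a f)"
  define f where "f = the (find (P a) (G @ H))"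
  define \<eta> where "\<eta> = (SOME \<eta>. reduces_with lt H h f \<eta> a)"
  define r where "r = txmon a 0 * h - \<eta> * f"
  from assms have "\<exists>a. \<exists>f\<in>set (G @ H). P a f"
    unfolding nf_continue.simps P_def by blast
  then have ex: "\<exists>f\<in>set (G @ H). P a f"
    unfolding a_def by (rule LeastI_ex)
  then have "find (P a) (G @ H) \<noteq> None"
    by (simp only: find_None_iff) blast
  then have "find (P a) (G @ H) = Some f"
    by (simp add: f_def)
  then have f: "f \<in> set (G @ H)" "P a f"
    by (metis find_Some_iff nth_mem)+
  from f(2) have red: "reduces_with lt H h f \<eta> a"
    unfolding P_def \<eta>_def by (rule someI_ex)
  have least: "a \<le> b" if "f' \<in> set (G @ H)" "reduces_with lt H h f' \<eta>' b" for f' \<eta>' b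
    unfolding a_def by (rule Least_le) (use that P_def in blast)
  have step: "nf_step lt G (h, H) = (strip_t r, if a > 0 then H @ [h] else H)"
    unfolding nf_step.simps Let_def r_def \<eta>_def f_def a_def P_fun by (rule refl)
  show thesis
  proof (cases "r = 0")
    case True
    show thesis
      by (rule that[OF f(1) red least, where e = 0 and h' = 0])
        (use True step in \<open>auto simp: r_def\<close>)
  next
    case False
    then obtain e where "r = txmon e 0 * strip_t r" by (rule strip_t_factor)
    then show thesis
      by (intro that[OF f(1) red least, where e = e and h' = "strip_t r"])
        (use step in \<open>auto simp: r_def\<close>)
  qed
qed

context total_mon_order
begin

lemma headed_imp_below: "headed d \<tau> p \<Longrightarrow> lt \<tau> \<sigma> \<Longrightarrow> below d \<sigma> p"
  unfolding headed_def below_def by (metis lt_trans)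

lemma below_mono: "below d \<tau> p \<Longrightarrow> lt \<tau> \<sigma> \<Longrightarrow> below d \<sigma> p"
  unfolding below_def using lt_trans by blast

lemma headed_one: "headed 0 0 1"
  by (simp add: headed_def tdeg_def zero_prod_def)

lemma reduction_cancels:
  assumes "headed d \<tau> h" "homogeneous f" "reduces_with lt H h f \<eta> a"
  shows "headed (a + d) \<tau> (\<eta> * f)" "below (a + d) \<tau> (txmon a 0 * h - \<eta> * f)"
proof -
  from assms(3) have "f \<noteq> 0" "\<eta> \<in> terms_t"
    and LT: "LT (hom_less lt) (\<eta> * f) = LT (hom_less lt) (txmon a 0 * h)"
    by (auto simp: reduces_with_def)
  moreover from this(2) assms(2) obtain d' where "hom_of_degree d' (\<eta> * f)"
    using homogeneous_term_mult by blast
  ultimately show "headed (a + d) \<tau> (\<eta> * f)" "below (a + d) \<tau> (txmon a 0 * h - \<eta> * f)"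
    using cancel_leading_term[OF LT _ _ headed_txmon_mult[OF assms(1)]] terms_nonzero by blast+
qed

text \<open>
  A division of \<open>p\<close> by \<open>A\<close> with remainder \<open>h\<close>, up to a power of \<open>t\<close> and a factor \<open>u\<close> with
  leading monomial \<open>1\<close> at \<open>t = 1\<close>. As soon as one reduction took place, a summand from \<open>A\<close>
  carries the leading monomial of \<open>p\<close> and \<open>h\<close> lies below it; this is the second notion. The weak
  notion also admits the input \<open>h = p\<close>, with \<open>q = 0\<close>: the algorithm may store it and reduce with
  it later.
\<close>

definition weakly_represented ::
    "('n, 'k::field) tpol set \<Rightarrow> nat \<Rightarrow> 'n mon \<Rightarrow> ('n, 'k) tpol \<Rightarrow> ('n, 'k) tpol \<Rightarrow> bool"
  where "weakly_represented A d \<sigma> p h \<longleftrightarrow> (\<exists>D u c q. headed D 0 u \<and>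
    hom_of_degree (D + d) (txmon c 0 * h) \<and> u * p = q + txmon c 0 * h \<and>
    (q = 0 \<or> q \<in> headed_sums A (D + d) \<sigma>))"

definition represented ::
    "('n, 'k::field) tpol set \<Rightarrow> nat \<Rightarrow> 'n mon \<Rightarrow> ('n, 'k) tpol \<Rightarrow> ('n, 'k) tpol \<Rightarrow> bool"
  where "represented A d \<sigma> p h \<longleftrightarrow> (\<exists>D u c q. headed D 0 u \<and>
    below (D + d) \<sigma> (txmon c 0 * h) \<and> u * p = q + txmon c 0 * h \<and>
    q \<in> headed_sums A (D + d) \<sigma>)"

lemma represented_weakly: "represented A d \<sigma> p h \<Longrightarrow> weakly_represented A d \<sigma> p h"
  unfolding represented_def weakly_represented_def using below_hom by blast

lemma weakly_represented_self: "headed d \<sigma> p \<Longrightarrow> weakly_represented A d \<sigma> p p"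
  unfolding weakly_represented_def
  by (rule exI[of _ 0], rule exI[of _ 1], rule exI[of _ 0], rule exI[of _ 0])
    (simp add: headed_one headed_hom)

lemma weakly_represented_homogeneous: "weakly_represented A d \<sigma> p h \<Longrightarrow> homogeneous h"
  unfolding weakly_represented_def homogeneous_iff using hom_of_degree_txmon_cancel by blast

text \<open>
  At the start nothing is stored, so \<open>p\<close> itself is reduced by an element of \<open>A\<close>, and this
  supplies the leading summand.
\<close>

lemma represented_first_step:
  assumes head: "headed d \<sigma> p" and f: "homogeneous f" "f \<in> A"
    and red: "reduces_with lt H p f \<eta> a"
    and step: "txmon a 0 * p - \<eta> * f = txmon e 0 * h'"
  shows "represented A d \<sigma> p h'"
proof -
  note cancel = reduction_cancels[OF head f(1) red]
  have "headed a 0 (txmon a 0)"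
    using headed_txmon_mult[OF headed_one, of a] by simp
  moreover have "below (a + d) \<sigma> (txmon e 0 * h')"
    using cancel(2) step by simp
  moreover have "txmon a 0 * p = \<eta> * f + txmon e 0 * h'"
    using step by (simp add: algebra_simps)
  moreover have "\<eta> * f + 0 \<in> headed_sums A (a + d) \<sigma>"
    using cancel(1) f(2) red zero_in_lower_sums
    unfolding headed_sums_def reduces_with_def by blast
  ultimately show ?thesis
    unfolding represented_def by (metis add_0_right)
qed

text \<open>
  Since \<open>h\<close> already lies below \<open>\<sigma>\<close>, so does the multiple of \<open>f\<close> that cancels its leading term:
  it joins the lower summands, and \<open>u\<close> changes only by a power of \<open>t\<close>.
\<close>

lemma represented_step:
  assumes rep: "represented A d \<sigma> p h" and head: "headed dh \<tau> h"
    and f: "homogeneous f" "f \<in> A"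
    and red: "reduces_with lt H h f \<eta> a"
    and step: "txmon a 0 * h - \<eta> * f = txmon e 0 * h'"
  shows "represented A d \<sigma> p h'"
proof -
  note cancel = reduction_cancels[OF head f(1) red]
  from rep obtain D u c q where u: "headed D 0 u" and low: "below (D + d) \<sigma> (txmon c 0 * h)"
    and eq: "u * p = q + txmon c 0 * h" and q: "q \<in> headed_sums A (D + d) \<sigma>"
    unfolding represented_def by blast
  have headc: "headed (c + dh) \<tau> (txmon c 0 * h)"
    by (rule headed_txmon_mult[OF head])
  then have deg: "c + dh = D + d"
    using hom_of_degree_unique headed_hom below_hom[OF low] headed_nonzero by blast
  have "lt \<tau> \<sigma>"
    using headc low unfolding headed_def below_def by blast
  have deg': "c + (a + dh) = (a + D) + d" using deg by simp
  have "headed (a + D) 0 (txmon a 0 * u)"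
    by (rule headed_txmon_mult[OF u])
  moreover have "below ((a + D) + d) \<sigma> (txmon (c + e) 0 * h')"
  proof -
    have "below (c + (a + dh)) \<tau> (txmon c 0 * (txmon e 0 * h'))"
      using below_txmon_mult cancel(2) step by metis
    then show ?thesis
      using deg' below_mono[OF _ \<open>lt \<tau> \<sigma>\<close>] by (simp add: txmon_mult flip: mult.assoc)
  qed
  moreover have "(txmon a 0 * u) * p = (txmon a 0 * q + (txmon c 0 * \<eta>) * f) + txmon (c + e) 0 * h'"
  proof -
    have "(txmon a 0 * u) * p = txmon a 0 * (q + txmon c 0 * h)"
      by (simp add: mult.assoc eq)
    also have "\<dots> = txmon a 0 * q + (txmon c 0 * \<eta>) * f + txmon c 0 * (txmon a 0 * h - \<eta> * f)"
      by (simp add: algebra_simps)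
    also have "txmon c 0 * (txmon a 0 * h - \<eta> * f) = txmon (c + e) 0 * h'"
      by (simp add: step txmon_mult flip: mult.assoc)
    finally show ?thesis .
  qed
  moreover have "txmon a 0 * q + (txmon c 0 * \<eta>) * f \<in> headed_sums A ((a + D) + d) \<sigma>"
  proof (rule headed_sums_add_lower)
    show "txmon a 0 * q \<in> headed_sums A ((a + D) + d) \<sigma>"
      using headed_sums_txmon_mult[OF q, of a] by (simp add: add.assoc)
    show "(txmon c 0 * \<eta>) * f \<in> lower_sums A ((a + D) + d) \<sigma>"
    proof (rule summand_in_lower_sums[OF _ f(2)])
      show "txmon c 0 * \<eta> \<in> terms_t"
        using red terms_mult txmon_in_terms unfolding reduces_with_def by blast
      show "below ((a + D) + d) \<sigma> ((txmon c 0 * \<eta>) * f)"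
        using headed_imp_below[OF headed_txmon_mult[OF cancel(1), of c] \<open>lt \<tau> \<sigma>\<close>] deg'
        by (simp add: mult.assoc)
    qed
  qed
  ultimately show ?thesis
    unfolding represented_def by blast
qed

end

context normal_mon_order
begin

text \<open>
  A reduction by a stored result \<open>g\<close> combines the divisions for \<open>h\<close> and \<open>g\<close>, the latter
  multiplied by \<open>\<eta>\<close>. The monomial \<open>\<nu>\<close> of \<open>\<eta>\<close> at \<open>t = 1\<close> lies strictly below \<open>1\<close>, as \<open>h\<close> and \<open>g\<close>
  have different leading monomials there. By normality, \<open>\<eta>\<close> moves the factor for \<open>g\<close> below \<open>1\<close>
  and all its summands, including the leading one, below \<open>\<sigma>\<close>; so the leading parts of the
  division for \<open>h\<close> survive.
\<close>

lemma represented_step_earlier: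
  fixes p h g :: "('n, 'k) tpol"
  assumes rep: "represented A d \<sigma> p h" and head: "headed dh \<tau> h"
    and g: "weakly_represented A d \<sigma> p g" "g \<in> set H"
    and decr: "\<And>m. m \<in> Poly_Mapping.keys h \<Longrightarrow> lt (snd m) (snd (LM (hom_less lt) g))"
    and red: "reduces_with lt H h g \<eta> a"
    and step: "txmon a 0 * h - \<eta> * g = txmon e 0 * h'"
  shows "represented A d \<sigma> p h'"
proof -
  note cancel = reduction_cancels[OF head weakly_represented_homogeneous[OF g(1)] red]
  from rep obtain D u c q where u: "headed D 0 u" and low: "below (D + d) \<sigma> (txmon c 0 * h)"
    and eq: "u * p = q + txmon c 0 * h" and q: "q \<in> headed_sums A (D + d) \<sigma>"
    unfolding represented_def by blast
  from g(1) obtain D' u' c' q' where u': "headed D' 0 u'"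
    and hom: "hom_of_degree (D' + d) (txmon c' 0 * g)"
    and eq': "u' * p = q' + txmon c' 0 * g" and q': "q' = 0 \<or> q' \<in> headed_sums A (D' + d) \<sigma>"
    unfolding weakly_represented_def by blast
  from red have "g \<noteq> 0" and "\<eta> \<in> terms_t" by (auto simp: reduces_with_def)
  then obtain k \<nu> \<kappa> where \<eta>: "\<eta> = Poly_Mapping.single (k, \<nu>) \<kappa>" "\<kappa> \<noteq> 0"
    unfolding terms_t_def by auto
  define dg where "dg = D' + d - c'"
  define \<rho> where "\<rho> = snd (LM (hom_less lt) g)"
  have headg: "headed dg \<rho> g"
    unfolding \<rho>_def dg_def using headed_LM[OF hom_of_degree_txmon_cancel[OF hom] \<open>g \<noteq> 0\<close>] .
  have headc: "headed (c + dh) \<tau> (txmon c 0 * h)"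
    by (rule headed_txmon_mult[OF head])
  then have deg: "c + dh = D + d"
    using hom_of_degree_unique headed_hom below_hom[OF low] headed_nonzero by blast
  have "lt \<tau> \<sigma>"
    using headc low unfolding headed_def below_def by blast
  have "c' + dg = D' + d"
    using hom_of_degree_unique[OF headed_hom[OF headed_txmon_mult[OF headg]] hom]
      headed_nonzero[OF headed_txmon_mult[OF headg]] by blast
  moreover have "tdeg (k, \<nu>) + dg = a + dh"
    using hom_of_degree_unique[OF hom_of_degree_single_mult[OF headed_hom[OF headg]]
        headed_hom[OF cancel(1)[unfolded \<eta>]]] headed_nonzero[OF cancel(1)] \<eta>(1) by blast
  ultimately have deg': "tdeg (k + c, \<nu>) + D' = a + c' + D"
    using deg by (simp add: tdeg_def)
  \<comment> \<open>For \<open>\<nu> = 0\<close>, the polynomials \<open>h\<close> and \<open>g\<close> would have the same leading monomial at \<open>t = 1\<close>.\<close>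
  have "\<nu> \<noteq> 0"
  proof
    assume "\<nu> = 0"
    then have "headed (tdeg (k, \<nu>) + dg) \<rho> (\<eta> * g)"
      using headed_single_mult[OF headg \<eta>(2), of 0 k] \<eta>(1) by simp
    from LM_headed(2)[OF this] LM_headed(2)[OF cancel(1)] have "\<rho> = \<tau>" by simp
    moreover from head decr have "lt \<tau> \<rho>"
      unfolding headed_def \<rho>_def by blast
    ultimately show False using lt_irrefl by blast
  qed
  moreover have "LM lt (dehom \<eta>) = \<nu>"
    by (simp add: \<eta> dehom_single LM_single[OF total])
  ultimately have "lt \<nu> 0"
    using red g(2) by (auto simp: reduces_with_def)
  \<comment> \<open>The common degree of the two factors of \<open>p\<close> that are combined.\<close>
  define D2 where "D2 = a + c' + D"
  define \<zeta> where "\<zeta> = Poly_Mapping.single (k + c, \<nu>) (-\<kappa>)"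
  have \<zeta>: "\<zeta> = - (txmon c 0 * \<eta>)"
    by (simp add: \<zeta>_def \<eta> txmon_def mult_single single_uminus add.commute)
  have deg2: "tdeg (k + c, \<nu>) + (D' + d) = D2 + d" "c' + c + (a + dh) = D2 + d"
    using deg deg' by (simp_all add: D2_def)
  have "headed D2 0 (txmon (a + c') 0 * u + \<zeta> * u')"
  proof (rule headed_add_below)
    show "headed D2 0 (txmon (a + c') 0 * u)"
      unfolding D2_def by (rule headed_txmon_mult[OF u])
    show "below D2 0 (\<zeta> * u')"
      using normal_headed[OF u' \<open>lt \<nu> 0\<close>, of "k + c" "-\<kappa>"] deg' by (simp add: \<zeta>_def D2_def)
  qed
  moreover have "below (D2 + d) \<sigma> (txmon (c' + c + e) 0 * h')"
  proof -
    have "below (c' + c + (a + dh)) \<tau> (txmon (c' + c) 0 * (txmon e 0 * h'))"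
      using below_txmon_mult cancel(2) step by metis
    then show ?thesis
      using deg2(2) below_mono[OF _ \<open>lt \<tau> \<sigma>\<close>] by (simp add: txmon_mult flip: mult.assoc)
  qed
  moreover have "(txmon (a + c') 0 * u + \<zeta> * u') * p =
      (txmon (a + c') 0 * q + \<zeta> * q') + txmon (c' + c + e) 0 * h'"
  proof -
    have c'c: "txmon (c' + c) 0 = txmon c' 0 * (txmon c 0 :: ('n, 'k) tpol)"
      by (simp add: txmon_mult)
    have "(txmon (a + c') 0 * u + \<zeta> * u') * p =
        txmon (a + c') 0 * (u * p) + \<zeta> * (u' * p)"
      by (simp add: algebra_simps)
    also have "\<dots> = (txmon (a + c') 0 * q + \<zeta> * q') +
        (txmon (a + c') 0 * txmon c 0 * h + \<zeta> * txmon c' 0 * g)"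
      unfolding eq eq' by (simp add: algebra_simps)
    also have "txmon (a + c') 0 * txmon c 0 = txmon (c' + c) 0 * (txmon a 0 :: ('n, 'k) tpol)"
      by (simp add: txmon_mult ac_simps)
    also have "\<zeta> * txmon c' 0 = - (txmon (c' + c) 0 * \<eta>)"
      unfolding \<zeta> c'c by (simp add: ac_simps)
    also have "txmon (c' + c) 0 * txmon a 0 * h + - (txmon (c' + c) 0 * \<eta>) * g =
        txmon (c' + c) 0 * (txmon a 0 * h - \<eta> * g)"
      by (simp add: algebra_simps)
    also have "\<dots> = txmon (c' + c + e) 0 * h'"
      by (simp add: step txmon_mult flip: mult.assoc)
    finally show ?thesis .
  qed
  moreover have "txmon (a + c') 0 * q + \<zeta> * q' \<in> headed_sums A (D2 + d) \<sigma>"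
  proof (rule headed_sums_add_lower)
    show "txmon (a + c') 0 * q \<in> headed_sums A (D2 + d) \<sigma>"
      using headed_sums_txmon_mult[OF q, of "a + c'"] by (simp add: D2_def add.assoc)
    show "\<zeta> * q' \<in> lower_sums A (D2 + d) \<sigma>"
      using q'
    proof
      assume "q' \<in> headed_sums A (D' + d) \<sigma>"
      then show ?thesis
        unfolding \<zeta>_def deg2(1)[symmetric]
        by (rule headed_sums_single_mult_lower)
          (use \<eta>(2) normal_below normal_headed \<open>lt \<nu> 0\<close> in auto)
    qed (simp add: zero_in_lower_sums)
  qed
  ultimately show ?thesis
    unfolding represented_def by blast
qed

text \<open>
  Leading monomials at \<open>t = 1\<close> strictly decrease along the run, so the current polynomial lies
  below everything stored. The start is kept apart because it is only weakly represented.
\<close>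

definition nf_invariant ::
    "('n, 'k) tpol list \<Rightarrow> nat \<Rightarrow> 'n mon \<Rightarrow> ('n, 'k) tpol \<Rightarrow>
      ('n, 'k) tpol \<times> ('n, 'k) tpol list \<Rightarrow> bool"
  where "nf_invariant G d \<sigma> p s \<longleftrightarrow> s = (p, []) \<or>
    represented (set G) d \<sigma> p (fst s) \<and>
    (\<forall>g\<in>set (snd s). weakly_represented (set G) d \<sigma> p g \<and>
      (\<forall>m\<in>Poly_Mapping.keys (fst s). lt (snd m) (snd (LM (hom_less lt) g))))"

lemma nf_invariant_weakly:
  assumes "headed d \<sigma> p" "nf_invariant G d \<sigma> p s"
  shows "weakly_represented (set G) d \<sigma> p (fst s)"
    and "g \<in> set (snd s) \<Longrightarrow> weakly_represented (set G) d \<sigma> p g"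
  using assms represented_weakly weakly_represented_self unfolding nf_invariant_def by auto

lemma nf_invariant_step:
  assumes p: "headed d \<sigma> p" and G: "\<forall>g\<in>set G. homogeneous g"
    and inv: "nf_invariant G d \<sigma> p (h, H)"
    and cont: "nf_continue lt G (h, H)"
    and f: "f \<in> set (G @ H)" "reduces_with lt H h f \<eta> a"
    and step: "txmon a 0 * h - \<eta> * f = txmon e 0 * h'"
  shows "nf_invariant G d \<sigma> p (h', if a > 0 then H @ [h] else H)"
    and "\<And>m. m \<in> Poly_Mapping.keys h' \<Longrightarrow>
      tdeg m + e = a + tdeg (LM (hom_less lt) h) \<and> lt (snd m) (snd (LM (hom_less lt) h))"
proof -
  let ?\<tau> = "snd (LM (hom_less lt) h)"
  from cont have "h \<noteq> 0" by simp
  note weak = nf_invariant_weakly[OF p inv]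
  obtain dh where "hom_of_degree dh h"
    using weakly_represented_homogeneous[OF weak(1)] unfolding homogeneous_iff by auto
  with \<open>h \<noteq> 0\<close> have head: "headed dh ?\<tau> h" by (intro headed_LM)
  have hom_f: "homogeneous f"
  proof (cases "f \<in> set G")
    case False
    with f(1) have "f \<in> set (snd (h, H))" by simp
    from weak(2)[OF this] show ?thesis by (rule weakly_represented_homogeneous)
  qed (use G in blast)
  have low: "below (a + dh) ?\<tau> (txmon e 0 * h')"
    using reduction_cancels(2)[OF head hom_f f(2)] step by simp
  show decr: "tdeg m + e = a + tdeg (LM (hom_less lt) h) \<and> lt (snd m) ?\<tau>"
    if "m \<in> Poly_Mapping.keys h'" for m
    using low that LM_headed(1)[OF head]
    by (force simp: below_def txmon_def keys_single_mult tdeg_add)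
  have rep: "represented (set G) d \<sigma> p h'"
  proof (cases "(h, H) = (p, [])")
    case True
    then have h: "h = p" and "f \<in> set G"
      using f(1) by auto
    then show ?thesis
      using represented_first_step[OF p hom_f _ f(2)[unfolded h] step[unfolded h]] by blast
  next
    case False
    with inv have h: "represented (set G) d \<sigma> p h"
      and H: "\<forall>g\<in>set H. \<forall>m\<in>Poly_Mapping.keys h. lt (snd m) (snd (LM (hom_less lt) g))"
      unfolding nf_invariant_def by auto
    show ?thesis
    proof (cases "f \<in> set H")
      case True
      show ?thesis
        by (rule represented_step_earlier[OF h head _ True _ f(2) step])
          (use weak(2) H True in auto)
    next
      case False
      with f(1) have "f \<in> set G" by simp
      then show ?thesis
        using represented_step[OF h head hom_f _ f(2) step] by blast
    qed
  qed
  have earlier: "weakly_represented (set G) d \<sigma> p g \<and>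
      (\<forall>m\<in>Poly_Mapping.keys h'. lt (snd m) (snd (LM (hom_less lt) g)))"
    if "g \<in> set (H @ [h])" for g
  proof (cases "g = h")
    case True
    then show ?thesis using weak(1) decr by simp
  next
    case False
    with that have g: "g \<in> set H" by simp
    then have "lt ?\<tau> (snd (LM (hom_less lt) g))"
      using inv head unfolding nf_invariant_def headed_def by fastforce
    then show ?thesis
      using weak(2)[of g] g decr lt_trans by (metis snd_conv)
  qed
  with rep show "nf_invariant G d \<sigma> p (h', if a > 0 then H @ [h] else H)"
    unfolding nf_invariant_def by auto
qed

lemma normal_form_represented:
  fixes G :: "('n, 'k) tpol list"
  assumes p: "headed d \<sigma> p" and G: "\<forall>g\<in>set G. homogeneous g"
    and nf: "normal_form lt p G = Some q"
  shows "q = p \<or> represented (set G) d \<sigma> p q"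
proof -
  from nf obtain s where s: "while_option (nf_continue lt G) (nf_step lt G) (p, []) = Some s"
    and q: "q = fst s"
    unfolding normal_form_def by auto
  have "nf_invariant G d \<sigma> p s"
  proof (rule while_option_rule[OF _ s])
    fix s assume inv: "nf_invariant G d \<sigma> p s" and cont: "nf_continue lt G s"
    obtain h H where s: "s = (h, H)" by (cases s)
    from cont[unfolded s] show "nf_invariant G d \<sigma> p (nf_step lt G s)"
    proof (rule nf_step_cases)
      fix f \<eta> a e h'
      assume "f \<in> set (G @ H)" "reduces_with lt H h f \<eta> a" "txmon a 0 * h - \<eta> * f = txmon e 0 * h'"
        and "nf_step lt G (h, H) = (h', if a > 0 then H @ [h] else H)"
      then show ?thesis
        using nf_invariant_step(1)[OF p G inv[unfolded s] cont[unfolded s]] s by metis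
    qed
  qed (simp add: nf_invariant_def)
  with q show ?thesis
    unfolding nf_invariant_def by auto
qed

text \<open>
  The normal form itself may be the leading summand (if no reduction applied), one of the lower
  summands, or zero.
\<close>

lemma normal_form_headed_sum:
  fixes G :: "('n, 'k) tpol list"
  assumes p: "headed d \<sigma> p" and G: "\<forall>g\<in>set G. homogeneous g"
    and nf: "normal_form lt p G = Some q"
  shows "\<exists>D u. headed D 0 u \<and> u * p \<in> headed_sums (set G \<union> {q}) (D + d) \<sigma>"
  using normal_form_represented[OF assms]
proof
  assume "q = p"
  then have "1 * q + 0 \<in> headed_sums (set G \<union> {q}) (0 + d) \<sigma>"
    using p zero_in_lower_sums txmon_in_terms[of 0 0] txmon_zero
    unfolding headed_sums_def by (intro CollectI exI conjI) auto
  then show ?thesis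
    using \<open>q = p\<close> headed_one by (intro exI[of _ 0] exI[of _ 1]) simp
next
  assume "represented (set G) d \<sigma> p q"
  then obtain D u c r where u: "headed D 0 u" "u * p = r + txmon c 0 * q"
    and low: "below (D + d) \<sigma> (txmon c 0 * q)" and r: "r \<in> headed_sums (set G) (D + d) \<sigma>"
    unfolding represented_def by blast
  have "r \<in> headed_sums (set G \<union> {q}) (D + d) \<sigma>"
    using r headed_sums_mono by blast
  moreover have "txmon c 0 * q \<in> lower_sums (set G \<union> {q}) (D + d) \<sigma>"
    using low by (intro summand_in_lower_sums) (auto simp: txmon_in_terms)
  ultimately show ?thesis
    using u headed_sums_add_lower by metis
qed


section \<open>Termination of the normal form algorithm\<close>

text \<open>
  A condition on leading monomials under which a polynomial reduces another one without
  multiplying it by a power of \<open>t\<close>, even if the reducing polynomial is a stored one (thus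
  \<open>lt \<nu> 0\<close>). The last conjunct makes \<open>\<nu> + snd m\<close> the leading exponent of the multiple.
\<close>

definition reduces_monomial :: "'n tmon \<Rightarrow> 'n tmon \<Rightarrow> bool"
  where "reduces_monomial m m' \<longleftrightarrow> fst m \<le> fst m' \<and> (\<exists>\<nu>. snd m' = \<nu> + snd m \<and> lt \<nu> 0 \<and>
    (\<forall>\<alpha>. lt \<alpha> (snd m) \<longrightarrow> lt (\<nu> + \<alpha>) (\<nu> + snd m)))"

lemma reduces_monomial_reduces_with:
  fixes g h :: "('n, 'k) tpol"
  assumes "headed d \<sigma> g" "headed d' \<sigma>' h"
    and red: "reduces_monomial (LM (hom_less lt) g) (LM (hom_less lt) h)"
  shows "\<exists>\<eta>. reduces_with lt H h g \<eta> 0"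
proof -
  let ?m = "LM (hom_less lt) g" and ?m' = "LM (hom_less lt) h"
  from red obtain \<nu> where le: "fst ?m \<le> fst ?m'" and \<nu>: "snd ?m' = \<nu> + snd ?m" "lt \<nu> 0"
    and shift: "\<And>\<alpha>. lt \<alpha> \<sigma> \<Longrightarrow> lt (\<nu> + \<alpha>) (\<nu> + \<sigma>)"
    using LM_headed[OF assms(1)] unfolding reduces_monomial_def by metis
  define m where "m = (fst ?m' - fst ?m, \<nu>)"
  define \<kappa> where "\<kappa> = Poly_Mapping.lookup h ?m' / Poly_Mapping.lookup g ?m"
  have nz: "Poly_Mapping.lookup g ?m \<noteq> 0" "Poly_Mapping.lookup h ?m' \<noteq> 0"
    using LM_in_keys[OF total_hom_less] headed_nonzero assms(1,2) by (auto simp: in_keys_iff)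
  then have "\<kappa> \<noteq> 0" by (simp add: \<kappa>_def)
  have m': "?m' = m + ?m"
    using le \<nu>(1) by (simp add: m_def prod_eq_iff)
  have head: "headed (tdeg m + d) (\<nu> + \<sigma>) (Poly_Mapping.single m \<kappa> * g)"
    unfolding m_def by (rule headed_single_mult[OF assms(1) \<open>\<kappa> \<noteq> 0\<close> shift])
  have "LM (hom_less lt) (Poly_Mapping.single m \<kappa> * g) = ?m'"
    unfolding m' using LM_headed[OF head] LM_headed[OF assms(1)]
    by (intro tmon_eqI) (simp_all add: tdeg_add, simp add: m_def)
  then have "LT (hom_less lt) (Poly_Mapping.single m \<kappa> * g) = LT (hom_less lt) h"
    using nz(1) by (simp add: LT_def) (simp add: m' lookup_single_mult \<kappa>_def)
  moreover have is_term: "Poly_Mapping.single m \<kappa> \<in> terms_t"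
    unfolding terms_t_def using \<open>\<kappa> \<noteq> 0\<close> by blast
  moreover have "LM lt (dehom (Poly_Mapping.single m \<kappa>)) = \<nu>"
    using \<open>\<kappa> \<noteq> 0\<close> by (simp add: dehom_single LM_single[OF total] m_def)
  ultimately have "reduces_with lt H h g (Poly_Mapping.single m \<kappa>) 0"
    using is_term \<nu>(2) headed_nonzero[OF assms(1)] unfolding reduces_with_def by simp
  then show ?thesis ..
qed

lemma finite_bounded_degree: "finite {\<alpha> :: 'n mon. tdeg (0, \<alpha>) \<le> D}"
proof (rule finite_imageD)
  have "Poly_Mapping.lookup \<alpha> i \<le> D" if "tdeg (0, \<alpha>) \<le> D" for \<alpha> :: "'n mon" and i
    using that member_le_sum[of i UNIV "Poly_Mapping.lookup \<alpha>"] by (simp add: tdeg_def)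
  then have "Poly_Mapping.lookup ` {\<alpha> :: 'n mon. tdeg (0, \<alpha>) \<le> D} \<subseteq> PiE UNIV (\<lambda>_. {..D})"
    by (auto simp: PiE_def)
  then show "finite (Poly_Mapping.lookup ` {\<alpha> :: 'n mon. tdeg (0, \<alpha>) \<le> D})"
    by (rule finite_subset) (intro finite_PiE, auto)
qed (auto simp: inj_on_def poly_mapping.lookup_inject)

text \<open>
  If infinitely many results were stored, \<open>wqo\<close> would give a stored one that reduces a later one
  with exponent \<open>0\<close> of \<open>t\<close>, whereas storing means that the minimal exponent is positive. So from
  some point on the exponent is always \<open>0\<close>. Then the degree does not grow any more, and the
  leading monomials at \<open>t = 1\<close>, being strictly decreasing, would be infinitely many monomials of
  bounded degree.
\<close>

lemma normal_form_terminates: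
  assumes p: "headed d \<sigma> p" and G: "\<forall>g\<in>set G. homogeneous g"
    and wqo: "\<And>m :: nat \<Rightarrow> 'n tmon. (\<And>i j. i < j \<Longrightarrow> lt (snd (m j)) (snd (m i))) \<Longrightarrow>
      \<exists>i j. i < j \<and> reduces_monomial (m i) (m j)"
  shows "\<exists>q. normal_form lt (p :: ('n, 'k) tpol) G = Some q"
proof (rule ccontr)
  define s where "s k = (nf_step lt G ^^ k) (p, [])" for k
  define h where "h k = fst (s k)" for k
  define H where "H k = snd (s k)" for k
  define m where "m k = LM (hom_less lt) (h k)" for k
  assume "\<nexists>q. normal_form lt p G = Some q"
  then have "while_option (nf_continue lt G) (nf_step lt G) (p, []) = None"
    unfolding normal_form_def by (cases "while_option (nf_continue lt G) (nf_step lt G) (p, [])") auto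
  then have cont: "nf_continue lt G (h k, H k)" for k
    unfolding while_option_def s_def h_def H_def by (simp split: if_splits)
  then have nz: "h k \<noteq> 0" for k by simp
  have s_Suc: "s (Suc k) = nf_step lt G (h k, H k)" for k
    by (simp add: s_def h_def H_def)
  have inv: "nf_invariant G d \<sigma> p (h k, H k)" for k
  proof (induction k)
    case (Suc k)
    from cont[of k] show ?case
    proof (rule nf_step_cases)
      fix f \<eta> a e h'
      assume "f \<in> set (G @ H k)" "reduces_with lt (H k) (h k) f \<eta> a"
        and "txmon a 0 * h k - \<eta> * f = txmon e 0 * h'"
        and "nf_step lt G (h k, H k) = (h', if a > 0 then H k @ [h k] else H k)"
      then show ?thesis
        using nf_invariant_step(1)[OF p G Suc cont] s_Suc[of k] h_def H_def
        by (metis fst_conv snd_conv)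
    qed
  qed (simp add: nf_invariant_def s_def h_def H_def)
  have "\<exists>a. (\<forall>f \<eta> b. f \<in> set (H k) \<longrightarrow> reduces_with lt (H k) (h k) f \<eta> b \<longrightarrow> a \<le> b) \<and>
      H (Suc k) = (if a > 0 then H k @ [h k] else H k) \<and>
      tdeg (m (Suc k)) \<le> a + tdeg (m k) \<and> lt (snd (m (Suc k))) (snd (m k))" for k
    using cont[of k]
  proof (rule nf_step_cases)
    fix f \<eta> a e h'
    assume step: "f \<in> set (G @ H k)" "reduces_with lt (H k) (h k) f \<eta> a"
        "txmon a 0 * h k - \<eta> * f = txmon e 0 * h'"
      and least: "\<And>f' \<eta>' b. f' \<in> set (G @ H k) \<Longrightarrow> reduces_with lt (H k) (h k) f' \<eta>' b \<Longrightarrow> a \<le> b"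
      and next_state: "nf_step lt G (h k, H k) = (h', if a > 0 then H k @ [h k] else H k)"
    have h': "h (Suc k) = h'" and H': "H (Suc k) = (if a > 0 then H k @ [h k] else H k)"
      using next_state s_Suc[of k] by (simp_all add: h_def[of "Suc k"] H_def[of "Suc k"])
    have "m (Suc k) \<in> Poly_Mapping.keys h'"
      unfolding m_def h'[symmetric] by (rule LM_in_keys[OF total_hom_less nz])
    then have "tdeg (m (Suc k)) + e = a + tdeg (m k) \<and> lt (snd (m (Suc k))) (snd (m k))"
      using nf_invariant_step(2)[OF p G inv cont step] unfolding m_def by blast
    then show ?thesis
      using least H' by (intro exI[of _ a]) auto
  qed
  then obtain a where a: "\<And>k f \<eta> b. f \<in> set (H k) \<Longrightarrow> reduces_with lt (H k) (h k) f \<eta> b \<Longrightarrow> a k \<le> b"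
    and H_Suc: "\<And>k. H (Suc k) = (if a k > 0 then H k @ [h k] else H k)"
    and deg: "\<And>k. tdeg (m (Suc k)) \<le> a k + tdeg (m k)"
    and m_Suc: "\<And>k. lt (snd (m (Suc k))) (snd (m k))"
    by metis
  have decr: "lt (snd (m j)) (snd (m i))" if "i < j" for i j
    using that by (induction j) (auto simp: less_Suc_eq intro: m_Suc dest: lt_trans[OF m_Suc])
  have "infinite {k. a k > 0}"
  proof
    assume "finite {k. a k > 0}"
    then obtain N where N: "\<And>k. k \<ge> N \<Longrightarrow> a k = 0"
      by (metis (mono_tags, lifting) finite_nat_set_iff_bounded leD mem_Collect_eq neq0_conv)
    have bound: "tdeg (m (N + k)) \<le> tdeg (m N)" for k
    proof (induction k)
      case (Suc k)
      then show ?case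
        using deg[of "N + k"] N[of "N + k"] by simp
    qed simp
    have "(\<lambda>k. snd (m (N + k))) ` UNIV \<subseteq> {\<alpha>. tdeg (0, \<alpha>) \<le> tdeg (m N)}"
      using bound by (force simp: tdeg_def intro: add_leD2)
    then have "finite (range (\<lambda>k. snd (m (N + k))))"
      using finite_bounded_degree finite_subset by blast
    moreover have "inj (\<lambda>k. snd (m (N + k)))"
    proof (rule injI)
      fix i j assume "snd (m (N + i)) = snd (m (N + j))"
      then show "i = j"
        using decr[of "N + i" "N + j"] decr[of "N + j" "N + i"] lt_irrefl
        by (cases i j rule: linorder_cases) auto
    qed
    ultimately show False
      using finite_imageD infinite_UNIV_nat by blast
  qed
  then obtain r :: "nat \<Rightarrow> nat" where r: "strict_mono r" "\<And>i. a (r i) > 0"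
    using infinite_enumerate by blast
  have "\<exists>i j. i < j \<and> reduces_monomial (m (r i)) (m (r j))"
    by (rule wqo[of "\<lambda>i. m (r i)"]) (use decr r(1) strict_monoD in blast)
  then obtain i j where ij: "i < j" "reduces_monomial (m (r i)) (m (r j))" by blast
  have kept: "h k \<in> set (H (Suc (k + n)))" if "a k > 0" for k n
    using that by (induction n) (auto simp: H_Suc)
  from ij(1) r(1) have "r i < r j" by (simp add: strict_monoD)
  then obtain n where "r j = Suc (r i + n)"
    using less_imp_Suc_add by blast
  with kept[OF r(2)[of i], of n] have mem: "h (r i) \<in> set (H (r j))" by simp
  have "\<exists>d \<sigma>. headed d \<sigma> (h k)" for k
    using weakly_represented_homogeneous[OF nf_invariant_weakly(1)[OF p inv]] headed_LM[OF _ nz]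
    unfolding homogeneous_iff by fastforce
  then obtain \<eta> where "reduces_with lt (H (r j)) (h (r j)) (h (r i)) \<eta> 0"
    using reduces_monomial_reduces_with ij(2) unfolding m_def by metis
  from a[OF mem this] r(2)[of j] show False by simp
qed

end


section \<open>Dickson's lemma and integral values of rational forms\<close>

lemma nat_mono_subseq:
  fixes x :: "nat \<Rightarrow> nat"
  obtains r :: "nat \<Rightarrow> nat" where "strict_mono r" "mono (\<lambda>i. x (r i))"
proof -
  obtain f where f: "strict_mono f" "monoseq (\<lambda>n. x (f n))"
    using seq_monosub[of x] by blast
  from f(2) consider "mono (\<lambda>i. x (f i))" | "\<forall>m n. m \<le> n \<longrightarrow> x (f n) \<le> x (f m)"
    unfolding monoseq_def mono_def by blast
  then show thesis
  proof cases
    case 1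
    show thesis by (rule that[OF f(1) 1])
  next
    case 2
    obtain N where N: "\<And>n. x (f N) \<le> x (f n)"
      using ex_has_least_nat[of "\<lambda>_. True" 0 "\<lambda>n. x (f n)"] by blast
    have "x (f (N + n)) = x (f N)" for n
      using 2 N[of "N + n"] by (simp add: le_antisym)
    then show thesis
      using f(1) by (intro that[of "\<lambda>n. f (N + n)"]) (auto simp: strict_mono_def mono_def)
  qed
qed

text \<open>
  Dickson's lemma for finitely many coordinates, by thinning out once for every coordinate.
\<close>

lemma finite_family_mono_subseq:
  fixes v :: "'c \<Rightarrow> nat \<Rightarrow> nat"
  assumes "finite C"
  obtains r :: "nat \<Rightarrow> nat" where "strict_mono r" "\<And>c. c \<in> C \<Longrightarrow> mono (\<lambda>i. v c (r i))"
proof -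
  from assms have "\<exists>r :: nat \<Rightarrow> nat. strict_mono r \<and> (\<forall>c\<in>C. mono (\<lambda>i. v c (r i)))"
  proof (induction C)
    case empty
    show ?case by (intro exI[of _ id]) (simp add: strict_mono_def)
  next
    case (insert c C)
    then obtain r :: "nat \<Rightarrow> nat" where r: "strict_mono r" "\<forall>c\<in>C. mono (\<lambda>i. v c (r i))" by blast
    obtain r' :: "nat \<Rightarrow> nat" where r': "strict_mono r'" "mono (\<lambda>i. v c (r (r' i)))"
      using nat_mono_subseq[of "\<lambda>i. v c (r i)"] by blast
    have "mono (\<lambda>i. v c' (r (r' i)))" if "c' \<in> C" for c'
      using r(2) that strict_mono_mono[OF r'(1)] unfolding mono_def by blast
    moreover have "strict_mono (\<lambda>i. r (r' i))"
      using r(1) r'(1) by (simp add: strict_mono_def)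
    ultimately show ?case
      using r'(2) by (intro exI[of _ "\<lambda>i. r (r' i)"]) simp
  qed
  with that show thesis by blast
qed

lemma finite_common_denominator:
  assumes "finite Q" "Q \<subseteq> \<rat>"
  obtains D :: nat where "D > 0" "\<And>q. q \<in> Q \<Longrightarrow> real D * q \<in> \<int>"
proof -
  from assms have "\<exists>D::nat. D > 0 \<and> (\<forall>q\<in>Q. real D * q \<in> \<int>)"
  proof (induction Q)
    case (insert q Q)
    then obtain D :: nat where D: "D > 0" "\<forall>q\<in>Q. real D * q \<in> \<int>" by auto
    from insert.prems have "q \<in> \<rat>" by simp
    then obtain a b :: int where ab: "b > 0" "q = real_of_int a / real_of_int b"
      by (rule Rats_cases')
    have "real (nat b * D) * q = real_of_int (int D * a)"
      using ab by (simp add: field_simps)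
    moreover have "real (nat b * D) * q' = real_of_int b * (real D * q')" for q'
      using ab by simp
    ultimately have "real (nat b * D) * q' \<in> \<int>" if "q' \<in> insert q Q" for q'
      using that D(2) by (metis Ints_mult Ints_of_int insertE)
    then show ?case
      using D(1) ab(1) by (intro exI[of _ "nat b * D"]) simp
  qed (intro exI[of _ 1], simp)
  with that show thesis by blast
qed

lemma expvec_add: "expvec (\<alpha> + \<beta>) = expvec \<alpha> + expvec \<beta>"
  by (simp add: expvec_def lookup_add vec_eq_iff)

lemma expvec_zero [simp]: "expvec 0 = 0"
  by (simp add: expvec_def vec_eq_iff)

lemma linear_expvec:
  assumes "linear c"
  shows "c (expvec \<alpha>) = (\<Sum>i\<in>UNIV. real (Poly_Mapping.lookup \<alpha> i) * c (axis i 1))"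
proof -
  have "expvec \<alpha> = (\<Sum>i\<in>UNIV. real (Poly_Mapping.lookup \<alpha> i) *\<^sub>R axis i 1)"
    by (simp add: expvec_def vec_eq_iff axis_def if_distrib cong: if_cong)
  then show ?thesis
    using assms by (simp add: linear_sum linear_cmul)
qed


section \<open>Newton orderings\<close>

locale newton_order =
  fixes L :: "(real^'n::finite \<Rightarrow> real) set" and \<delta> :: "real^'n"
    and less0 :: "'n mon \<Rightarrow> 'n mon \<Rightarrow> bool"
  assumes finite_forms: "finite L" and nonempty_forms: "L \<noteq> {}"
    and linear_forms: "\<And>l. l \<in> L \<Longrightarrow> linear l"
    and semigroup: "semigroup_ordering less0"
begin

abbreviation lt :: "'n mon \<Rightarrow> 'n mon \<Rightarrow> bool"
  where "lt \<equiv> newton_less L \<delta> less0"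

lemma less0_irrefl: "\<not> less0 \<alpha> \<alpha>"
  using semigroup unfolding semigroup_ordering_def total_ordering_def by (blast dest: irreflpD)

lemma less0_trans: "less0 \<alpha> \<beta> \<Longrightarrow> less0 \<beta> \<gamma> \<Longrightarrow> less0 \<alpha> \<gamma>"
  using semigroup unfolding semigroup_ordering_def total_ordering_def by (blast dest: transpD)

lemma less0_total: "\<alpha> = \<beta> \<or> less0 \<alpha> \<beta> \<or> less0 \<beta> \<alpha>"
  using semigroup unfolding semigroup_ordering_def total_ordering_def totalp_on_def by blast

lemma less0_add: "less0 \<alpha> \<beta> \<Longrightarrow> less0 (\<gamma> + \<alpha>) (\<gamma> + \<beta>)"
  using semigroup unfolding semigroup_ordering_def by (simp add: add.commute)

lemma total_newton_less: "total_ordering lt"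
  unfolding total_ordering_def
proof (intro conjI irreflpI transpI totalpI)
  fix \<alpha> \<beta> :: "'n mon" assume "\<alpha> \<noteq> \<beta>"
  then show "lt \<alpha> \<beta> \<or> lt \<beta> \<alpha>"
    using less0_total[of \<alpha> \<beta>] unfolding newton_less_def by linarith
next
  fix \<alpha> \<beta> \<gamma> :: "'n mon" assume "lt \<alpha> \<beta>" "lt \<beta> \<gamma>"
  then show "lt \<alpha> \<gamma>"
    using less0_trans[of \<alpha> \<beta> \<gamma>] unfolding newton_less_def by linarith
qed (simp add: newton_less_def less0_irrefl)

sublocale total_mon_order lt
  by standard (rule total_newton_less)

lemma weight_le: "l \<in> L \<Longrightarrow> weight L e \<alpha> \<le> l (expvec \<alpha> + e)"
  unfolding weight_def using finite_forms by (intro Min_le) auto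

lemma weight_attained:
  obtains l where "l \<in> L" "weight L e \<alpha> = l (expvec \<alpha> + e)"
proof -
  have "weight L e \<alpha> \<in> (\<lambda>l. l (expvec \<alpha> + e)) ` L"
    unfolding weight_def using finite_forms nonempty_forms by (intro Min_in) auto
  with that show thesis by blast
qed

lemma zero_in_mon_cone: "l \<in> L \<Longrightarrow> 0 \<in> mon_cone L 0 l"
proof -
  assume "l \<in> L"
  obtain l' where "l' \<in> L" "weight L 0 (0 :: 'n mon) = l' (expvec (0 :: 'n mon) + 0)"
    by (rule weight_attained)
  with \<open>l \<in> L\<close> show ?thesis
    using linear_0[OF linear_forms, of l] linear_0[OF linear_forms, of l']
    by (simp add: mon_cone_def)
qed

text \<open>
  A form that attains the minimum at \<open>\<gamma> + \<alpha>\<close> splits additively, and each part is at least the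
  respective minimum.
\<close>

lemma weight_superadditive: "weight L 0 \<gamma> + weight L \<delta> \<alpha> \<le> weight L \<delta> (\<gamma> + \<alpha>)"
proof -
  obtain l where l: "l \<in> L" "weight L \<delta> (\<gamma> + \<alpha>) = l (expvec (\<gamma> + \<alpha>) + \<delta>)"
    by (rule weight_attained)
  have "l (expvec (\<gamma> + \<alpha>) + \<delta>) = l (expvec \<gamma> + 0) + l (expvec \<alpha> + \<delta>)"
    using linear_forms[OF l(1)] by (simp add: expvec_add linear_add[symmetric] add.assoc)
  then show ?thesis
    using l weight_le[OF l(1), of 0 \<gamma>] weight_le[OF l(1), of \<delta> \<alpha>] by linarith
qed

lemma weight_cone_add:
  assumes "l \<in> L" "\<gamma> \<in> mon_cone L 0 l" "\<sigma> \<in> mon_cone L \<delta> l"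
  shows "weight L \<delta> (\<gamma> + \<sigma>) = weight L 0 \<gamma> + weight L \<delta> \<sigma>"
proof -
  have "l (expvec (\<gamma> + \<sigma>) + \<delta>) = l (expvec \<gamma> + 0) + l (expvec \<sigma> + \<delta>)"
    using linear_forms[OF assms(1)] by (simp add: expvec_add linear_add[symmetric] add.assoc)
  then show ?thesis
    using assms(2,3) weight_le[OF assms(1), of \<delta> "\<gamma> + \<sigma>"] weight_superadditive[of \<gamma> \<sigma>]
    by (simp add: mon_cone_def)
qed

text \<open>
  Going from \<open>\<sigma>\<close> to \<open>\<gamma> + \<sigma>\<close> changes the weight by exactly the weight of \<open>\<gamma>\<close>, going from \<open>\<alpha>\<close> to
  \<open>\<gamma> + \<alpha>\<close> by no less, and larger weight means smaller monomial. Ties are decided by \<open>less0\<close>,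
  which is compatible with addition.
\<close>

lemma cone_shift:
  assumes "l \<in> L" "\<gamma> \<in> mon_cone L 0 l" "\<sigma> \<in> mon_cone L \<delta> l" "lt \<alpha> \<sigma>"
  shows "lt (\<gamma> + \<alpha>) (\<gamma> + \<sigma>)"
  using weight_cone_add[OF assms(1-3)] weight_superadditive[of \<gamma> \<alpha>] less0_add[of \<alpha> \<sigma> \<gamma>] assms(4)
  unfolding newton_less_def by linarith

text \<open>
  The weight is a minimum of affine functions, hence concave: its value at the midpoint \<open>\<mu>\<close> is
  at least the mean of its values at \<open>\<alpha>\<close> and \<open>\<beta>\<close>. If both lay below \<open>\<mu>\<close>, all three weights would
  agree, and the semigroup ordering \<open>less0\<close> cannot have both endpoints below the midpoint.
\<close>

lemma not_both_below_midpoint: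
  assumes "\<alpha> + \<beta> = \<mu> + \<mu>"
  shows "\<not> (lt \<alpha> \<mu> \<and> lt \<beta> \<mu>)"
proof
  assume below: "lt \<alpha> \<mu> \<and> lt \<beta> \<mu>"
  obtain l where l: "l \<in> L" "weight L \<delta> \<mu> = l (expvec \<mu> + \<delta>)"
    by (rule weight_attained)
  have "l (expvec \<alpha> + \<delta>) + l (expvec \<beta> + \<delta>) = l (expvec (\<alpha> + \<beta>) + (\<delta> + \<delta>))"
    using linear_forms[OF l(1)] by (simp add: expvec_add linear_add[symmetric] algebra_simps)
  also have "\<dots> = l (expvec \<mu> + \<delta>) + l (expvec \<mu> + \<delta>)"
    unfolding assms using linear_forms[OF l(1)]
    by (simp add: expvec_add linear_add[symmetric] algebra_simps)
  finally have "weight L \<delta> \<alpha> + weight L \<delta> \<beta> \<le> weight L \<delta> \<mu> + weight L \<delta> \<mu>"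
    using l weight_le[OF l(1), of \<delta> \<alpha>] weight_le[OF l(1), of \<delta> \<beta>] by linarith
  with below have "less0 \<alpha> \<mu>" "less0 \<beta> \<mu>"
    unfolding newton_less_def by linarith+
  then have "less0 (\<beta> + \<alpha>) (\<beta> + \<mu>)" "less0 (\<mu> + \<beta>) (\<mu> + \<mu>)"
    using less0_add by blast+
  then have "less0 (\<beta> + \<alpha>) (\<mu> + \<mu>)"
    using less0_trans by (simp add: add.commute)
  then show False
    using assms less0_irrefl by (simp add: add.commute)
qed

text \<open>
  If \<open>\<mu> = \<alpha> + m = \<alpha>' + m'\<close> is the leading monomial of both products, then \<open>\<alpha> + m'\<close> and \<open>\<alpha>' + m\<close>
  occur in them as well, and \<open>\<mu>\<close> is their midpoint.
\<close>

lemma LM_xmon_mult_inj: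
  fixes F :: "('n, 'k::field) pol"
  assumes "F \<noteq> 0" "LM lt (xmon \<alpha> * F) = LM lt (xmon \<alpha>' * F)"
  shows "\<alpha> = \<alpha>'"
proof (rule ccontr)
  assume "\<alpha> \<noteq> \<alpha>'"
  let ?\<mu> = "LM lt (xmon \<alpha> * F)"
  have keys: "Poly_Mapping.keys (xmon \<gamma> * F) = (+) \<gamma> ` Poly_Mapping.keys F"
    and nz: "xmon \<gamma> * F \<noteq> 0" for \<gamma>
    using assms(1) by (simp_all add: xmon_def keys_single_mult single_mult_eq_0_iff)
  obtain m where m: "m \<in> Poly_Mapping.keys F" "?\<mu> = \<alpha> + m"
    using LM_in_keys[OF total nz[of \<alpha>]] keys by auto
  obtain m' where m': "m' \<in> Poly_Mapping.keys F" "?\<mu> = \<alpha>' + m'"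
    using LM_in_keys[OF total nz[of \<alpha>']] keys assms(2) by auto
  from \<open>\<alpha> \<noteq> \<alpha>'\<close> m(2) m'(2) have "m \<noteq> m'" by auto
  then have "\<alpha> + m' \<noteq> ?\<mu>" "\<alpha>' + m \<noteq> ?\<mu>"
    using m(2) m'(2) by auto
  then have "lt (\<alpha> + m') ?\<mu>" "lt (\<alpha>' + m) ?\<mu>"
    using LM_greatest[OF total nz[of \<alpha>], of "\<alpha> + m'"]
      LM_greatest[OF total nz[of \<alpha>'], of "\<alpha>' + m"] m m' keys assms(2) by auto
  moreover have "(\<alpha> + m') + (\<alpha>' + m) = ?\<mu> + ?\<mu>"
    using m(2) m'(2) by (metis add.assoc add.commute)
  ultimately show False
    using not_both_below_midpoint by blast
qed

text \<open>
  On the cone, \<open>\<nu>\<close> changes the weight of \<open>\<sigma>\<close> by its own weight, which by superadditivity is at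
  most the change from the weight of \<open>1\<close> to that of \<open>\<nu>\<close>. So \<open>\<nu>\<close> lowers \<open>1\<close> whenever it lowers
  \<open>\<sigma>\<close>.
\<close>

lemma cone_difference_below_one:
  assumes "l \<in> L" "\<nu> \<in> mon_cone L 0 l" "\<sigma> \<in> mon_cone L \<delta> l" "lt (\<nu> + \<sigma>) \<sigma>"
  shows "lt \<nu> 0"
proof -
  have super: "weight L 0 \<nu> + weight L \<delta> 0 \<le> weight L \<delta> \<nu>"
    using weight_superadditive[of \<nu> 0] by simp
  have "less0 \<nu> 0" if "less0 (\<nu> + \<sigma>) \<sigma>"
    using that less0_total[of \<nu> 0] less0_add[of 0 \<nu> \<sigma>] less0_trans[of \<sigma> "\<nu> + \<sigma>" \<sigma>] less0_irrefl
    by (auto simp: add.commute)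
  then show ?thesis
    using assms(4) super weight_cone_add[OF assms(1-3)] unfolding newton_less_def by linarith
qed

text \<open>
  Infinitely many members lie in one cone \<open>M\<^sub>\<delta>(l)\<close>. With a common denominator, the rational
  forms that describe the cone of \<open>l\<close> take natural numbers as values on the shifted exponents,
  so Dickson's lemma applies to these values together with the exponents of \<open>t\<close>. If no form
  decreases from one member to a later one, all forms are nonnegative on the difference \<open>\<nu>\<close>,
  where the shift \<open>\<delta>\<close> cancels; so \<open>\<nu>\<close> lies in \<open>M(l)\<close>, and in particular has no negative entries.
\<close>

lemma decreasing_sequence_reduces:
  fixes m :: "nat \<Rightarrow> 'n tmon"
  assumes rational: "rational_forms L" and \<delta>: "\<forall>i. \<delta> $ i \<in> \<rat> \<and> 0 \<le> \<delta> $ i"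
    and decr: "\<And>i j. i < j \<Longrightarrow> lt (snd (m j)) (snd (m i))"
  shows "\<exists>i j. i < j \<and> fst (m i) \<le> fst (m j) \<and> (\<exists>\<nu>. snd (m j) = \<nu> + snd (m i) \<and> lt \<nu> 0 \<and>
    (\<forall>\<alpha>. lt \<alpha> (snd (m i)) \<longrightarrow> lt (\<nu> + \<alpha>) (\<nu> + snd (m i))))"
proof -
  have "\<exists>l\<in>L. snd (m k) \<in> mon_cone L \<delta> l" for k
  proof -
    obtain l where "l \<in> L" "weight L \<delta> (snd (m k)) = l (expvec (snd (m k)) + \<delta>)"
      by (rule weight_attained)
    then show ?thesis by (auto simp: mon_cone_def)
  qed
  then obtain form where form: "\<And>k. form k \<in> L" "\<And>k. snd (m k) \<in> mon_cone L \<delta> (form k)"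
    by metis
  from form(1) have "range form \<subseteq> L" by blast
  then have "finite (range form)"
    using finite_forms by (rule finite_subset)
  then obtain k0 where k0: "infinite {k. form k = form k0}"
    using pigeonhole_infinite[of UNIV form] by auto
  define l where "l = form k0"
  have l: "l \<in> L" using form(1) by (simp add: l_def)
  obtain r0 :: "nat \<Rightarrow> nat" where r0: "strict_mono r0" "\<And>i. form (r0 i) = l"
    using infinite_enumerate[OF k0] unfolding l_def by blast
  have cone: "snd (m (r0 i)) \<in> mon_cone L \<delta> l" for i
    using form(2) r0(2) by metis
  obtain \<Lambda> :: "(real^'n \<Rightarrow> real) set" where \<Lambda>: "finite \<Lambda>"
    "\<forall>c\<in>\<Lambda>. linear c \<and> (\<forall>i. c (axis i 1) \<in> \<rat>)" "form_cone L l = {a. \<forall>c\<in>\<Lambda>. c a \<ge> 0}"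
    using bspec[OF rational[unfolded rational_forms_def] l] by (elim exE conjE) (rule that)
  have in_cone: "expvec (snd (m (r0 i))) + \<delta> \<in> form_cone L l" for i
    using cone[of i] \<delta> by (simp add: form_cone_def mon_cone_def weight_def expvec_def)
  have "\<exists>D::nat. D > 0 \<and> (\<forall>\<alpha>. real D * c (expvec \<alpha> + \<delta>) \<in> \<int>)" if "c \<in> \<Lambda>" for c
  proof -
    have lin: "linear c" and rat: "\<And>i. c (axis i 1) \<in> \<rat>" using \<Lambda>(2) that by auto
    have "\<delta> = (\<Sum>i\<in>UNIV. \<delta> $ i *\<^sub>R axis i 1)"
      by (simp add: vec_eq_iff axis_def if_distrib cong: if_cong)
    then have "c \<delta> = c (\<Sum>i\<in>UNIV. \<delta> $ i *\<^sub>R axis i 1)" by (rule arg_cong)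
    also have "\<dots> = (\<Sum>i\<in>UNIV. \<delta> $ i * c (axis i 1))"
      using lin by (simp add: linear_sum linear_cmul)
    finally have "c \<delta> \<in> \<rat>"
      using rat \<delta> by (simp add: Rats_sum)
    with rat have "insert (c \<delta>) (range (\<lambda>i. c (axis i 1))) \<subseteq> \<rat>" by auto
    then obtain D :: nat where D: "D > 0"
      "\<And>q. q \<in> insert (c \<delta>) (range (\<lambda>i. c (axis i 1))) \<Longrightarrow> real D * q \<in> \<int>"
      using finite_common_denominator[of "insert (c \<delta>) (range (\<lambda>i. c (axis i 1)))"] by auto
    have "real D * c (expvec \<alpha> + \<delta>) \<in> \<int>" for \<alpha>
    proof -
      have "real D * c (expvec \<alpha> + \<delta>) =
          (\<Sum>i\<in>UNIV. real (Poly_Mapping.lookup \<alpha> i) * (real D * c (axis i 1))) + real D * c \<delta>"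
        by (simp add: linear_add[OF lin] linear_expvec[OF lin] distrib_left sum_distrib_left ac_simps)
      also have "\<dots> \<in> \<int>"
        by (intro Ints_add Ints_sum Ints_mult[of "real _" "real D * _"] D(2)) auto
      finally show ?thesis .
    qed
    with D(1) show ?thesis by blast
  qed
  then obtain D :: "(real^'n \<Rightarrow> real) \<Rightarrow> nat" where D: "\<And>c. c \<in> \<Lambda> \<Longrightarrow> D c > 0"
    "\<And>c \<alpha>. c \<in> \<Lambda> \<Longrightarrow> real (D c) * c (expvec \<alpha> + \<delta>) \<in> \<int>" by metis
  define val where "val c k = nat \<lfloor>real (D c) * c (expvec (snd (m (r0 k))) + \<delta>)\<rfloor>" for c k
  have val: "real (val c k) = real (D c) * c (expvec (snd (m (r0 k))) + \<delta>)" if c: "c \<in> \<Lambda>" for c k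
  proof -
    have "0 \<le> c (expvec (snd (m (r0 k))) + \<delta>)"
      using in_cone \<Lambda>(3) c by auto
    then have "0 \<le> real (D c) * c (expvec (snd (m (r0 k))) + \<delta>)" by simp
    moreover obtain z where "real (D c) * c (expvec (snd (m (r0 k))) + \<delta>) = real_of_int z"
      using D(2)[OF c] by (rule Ints_cases)
    ultimately show ?thesis by (simp add: val_def)
  qed
  \<comment> \<open>The coordinates for Dickson's lemma; \<open>None\<close> stands for the exponent of \<open>t\<close>.\<close>
  define v where "v x k = (case x of None \<Rightarrow> fst (m (r0 k)) | Some c \<Rightarrow> val c k)" for x k
  have "finite (insert None (Some ` \<Lambda>))" using \<Lambda>(1) by simp
  then obtain r :: "nat \<Rightarrow> nat" where r: "strict_mono r" "\<And>x. x \<in> insert None (Some ` \<Lambda>) \<Longrightarrow> mono (\<lambda>i. v x (r i))"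
  proof (rule finite_family_mono_subseq[where v = v])
    fix r :: "nat \<Rightarrow> nat"
    assume "strict_mono r" "\<And>x. x \<in> insert None (Some ` \<Lambda>) \<Longrightarrow> mono (\<lambda>i. v x (r i))"
    then show thesis by (rule that)
  qed
  define i where "i = r0 (r 0)"
  define j where "j = r0 (r 1)"
  have "i < j"
    using r(1) r0(1) by (simp add: i_def j_def strict_mono_less)
  have "fst (m i) \<le> fst (m j)"
    using r(2)[of None] by (simp add: mono_def v_def i_def j_def)
  have "expvec (snd (m j)) - expvec (snd (m i)) \<in> form_cone L l"
    unfolding \<Lambda>(3)
  proof (intro CollectI ballI)
    fix c assume c: "c \<in> \<Lambda>"
    then have "val c (r 0) \<le> val c (r 1)"
      using r(2)[of "Some c"] by (auto simp: mono_def v_def)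
    then have "real (D c) * c (expvec (snd (m i)) + \<delta>) \<le> real (D c) * c (expvec (snd (m j)) + \<delta>)"
      unfolding i_def j_def val[OF c, symmetric] by simp
    then have "c (expvec (snd (m i)) + \<delta>) \<le> c (expvec (snd (m j)) + \<delta>)"
      using D(1)[OF c] by simp
    then show "0 \<le> c (expvec (snd (m j)) - expvec (snd (m i)))"
      using \<Lambda>(2) c by (simp add: linear_add linear_diff)
  qed
  moreover define \<nu> where "\<nu> = snd (m j) - snd (m i)"
  ultimately have le: "Poly_Mapping.lookup (snd (m i)) x \<le> Poly_Mapping.lookup (snd (m j)) x" for x
    by (simp add: form_cone_def expvec_def)
  have \<nu>: "snd (m j) = \<nu> + snd (m i)"
    using le by (intro poly_mapping_eqI) (simp add: \<nu>_def lookup_add minus_poly_mapping.rep_eq)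
  then have "expvec \<nu> \<in> form_cone L l"
    using \<open>expvec (snd (m j)) - expvec (snd (m i)) \<in> form_cone L l\<close> by (simp add: expvec_add)
  then have \<nu>_cone: "\<nu> \<in> mon_cone L 0 l"
    by (simp add: form_cone_def mon_cone_def weight_def)
  have \<sigma>_cone: "snd (m i) \<in> mon_cone L \<delta> l"
    using cone by (simp add: i_def)
  have "lt \<nu> 0"
    using cone_difference_below_one[OF l \<nu>_cone \<sigma>_cone] decr[OF \<open>i < j\<close>] \<nu> by simp
  moreover have "\<forall>\<alpha>. lt \<alpha> (snd (m i)) \<longrightarrow> lt (\<nu> + \<alpha>) (\<nu> + snd (m i))"
    using cone_shift[OF l \<nu>_cone \<sigma>_cone] by blast
  ultimately show ?thesis
    using \<open>i < j\<close> \<open>fst (m i) \<le> fst (m j)\<close> \<nu> by blast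
qed

text \<open>
  The monomial \<open>\<mu>\<close> lies in the module, so it occurs in some product \<open>c \<sigma> * xmon \<sigma>\<close> of an
  expansion in the generators, and all monomials of \<open>c \<sigma>\<close> lie in \<open>M(l)\<close>. Taking \<open>1\<close> as
  coefficient of \<open>\<sigma>\<close> and \<open>0\<close> elsewhere shows that the generator lies in the module itself, hence
  in \<open>M\<^sub>\<delta>(l)\<close>.
\<close>

lemma module_generator_divides:
  fixes F :: "('n, 'k::field) pol"
  assumes l: "l \<in> L" and "finite S"
    and gen: "generates_over (Ralg L l :: ('n, 'k) pol set) S (Rmod L \<delta> less0 {F} l)"
    and \<mu>: "\<mu> \<in> LMset lt {F}" "\<mu> \<in> mon_cone L \<delta> l"
  obtains \<gamma> \<sigma> where "\<sigma> \<in> S" "\<sigma> \<in> mon_cone L \<delta> l" "\<gamma> \<in> mon_cone L 0 l" "\<mu> = \<gamma> + \<sigma>"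
proof -
  let ?A = "Ralg L l :: ('n, 'k) pol set"
  have Rmod: "Rmod L \<delta> less0 {F} l = {\<Sum>s\<in>S. c s * xmon s | c. \<forall>s\<in>S. c s \<in> ?A}"
    using gen unfolding generates_over_def .
  have "xmon \<mu> \<in> Rmod L \<delta> less0 {F} l"
    using \<mu> unfolding Rmod_def by (intro xmon_in_kspan) blast
  then obtain c where c: "xmon \<mu> = (\<Sum>s\<in>S. c s * xmon s)" "\<forall>s\<in>S. c s \<in> ?A"
    unfolding Rmod by blast
  have "(\<Sum>s\<in>S. Poly_Mapping.lookup (c s * xmon s) \<mu>) = Poly_Mapping.lookup (xmon \<mu> :: ('n, 'k) pol) \<mu>"
    unfolding c(1) by (simp add: lookup_sum)
  also have "\<dots> = 1" by (simp add: xmon_def)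
  finally have "(\<Sum>s\<in>S. Poly_Mapping.lookup (c s * xmon s) \<mu>) \<noteq> 0" by simp
  then obtain \<sigma> where \<sigma>: "\<sigma> \<in> S" "Poly_Mapping.lookup (c \<sigma> * xmon \<sigma>) \<mu> \<noteq> 0"
    by (rule sum.not_neutral_contains_not_neutral)
  then have "\<mu> \<in> Poly_Mapping.keys (Poly_Mapping.single \<sigma> 1 * c \<sigma>)"
    by (simp add: in_keys_iff xmon_def mult.commute)
  then obtain \<gamma> where \<gamma>: "\<gamma> \<in> Poly_Mapping.keys (c \<sigma>)" "\<mu> = \<gamma> + \<sigma>"
    by (auto simp: keys_single_mult add.commute)
  have "\<gamma> \<in> mon_cone L 0 l"
    using \<gamma>(1) c(2) \<sigma>(1) keys_kspan unfolding Ralg_def by blast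
  moreover have "\<sigma> \<in> mon_cone L \<delta> l"
  proof -
    have "xmon 0 \<in> ?A" "0 \<in> ?A"
      unfolding Ralg_def using zero_in_mon_cone[OF l] xmon_in_kspan zero_in_kspan by blast+
    then have "\<forall>s\<in>S. (if s = \<sigma> then xmon 0 else 0) \<in> ?A" by simp
    moreover have "(\<Sum>s\<in>S. (if s = \<sigma> then xmon 0 else 0) * xmon s) = (xmon \<sigma> :: ('n, 'k) pol)"
      using \<open>finite S\<close> \<sigma>(1) by (simp add: xmon_def if_distribR if_distrib cong: if_cong)
    ultimately have "(xmon \<sigma> :: ('n, 'k) pol) \<in> Rmod L \<delta> less0 {F} l"
      unfolding Rmod by (intro CollectI exI[of _ "\<lambda>s. if s = \<sigma> then xmon 0 else 0"]) simp
    then have "Poly_Mapping.keys (xmon \<sigma> :: ('n, 'k) pol) \<subseteq> LMset lt {F} \<inter> mon_cone L \<delta> l"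
      unfolding Rmod_def by (rule keys_kspan)
    then show ?thesis by (simp add: xmon_def)
  qed
  ultimately show thesis
    using that \<sigma>(1) \<gamma>(2) by blast
qed

end


section \<open>Reducing sets\<close>

context total_mon_order
begin

lemma headed_xmon_multiple:
  assumes "hom_of_degree d f" "f \<noteq> 0"
  shows "headed (tdeg (0, \<beta>) + d) (LM lt (xmon \<beta> * dehom f)) (txmon 0 \<beta> * f)"
proof -
  let ?P = "xmon \<beta> * dehom f"
  have "dehom f \<noteq> 0"
    using headed_dehom(2)[OF headed_LM[OF assms]] .
  then have P: "?P \<noteq> 0"
    by (simp add: xmon_def single_mult_eq_0_iff)
  have "Poly_Mapping.keys ?P = snd ` Poly_Mapping.keys (txmon 0 \<beta> * f)"
    by (simp add: xmon_def txmon_def keys_single_mult keys_dehom[OF assms(1)] image_image)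
  then have "LM lt ?P \<in> snd ` Poly_Mapping.keys (txmon 0 \<beta> * f)"
    and "\<And>m. m \<in> Poly_Mapping.keys (txmon 0 \<beta> * f) \<Longrightarrow>
      snd m = LM lt ?P \<or> lt (snd m) (LM lt ?P)"
    using LM_in_keys[OF total P] LM_greatest[OF total P] by blast+
  moreover have "hom_of_degree (tdeg (0, \<beta>) + d) (txmon 0 \<beta> * f)"
    unfolding txmon_def by (rule hom_of_degree_single_mult[OF assms(1)])
  ultimately show ?thesis
    unfolding headed_def hom_of_degree_def by blast
qed

lemma headed_sums_indexed:
  assumes "w \<in> headed_sums A d \<sigma>"
  obtains k :: nat and \<xi> h
  where "\<forall>i\<in>{1..k}. \<xi> i \<in> terms_t \<and> h i \<in> A"
    and "w = (\<Sum>i=1..k. \<xi> i * h i)" and "1 \<le> k" and "\<xi> 1 * h 1 \<noteq> 0"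
    and "LM (hom_less lt) w = LM (hom_less lt) (\<xi> 1 * h 1)"
    and "\<forall>i\<in>{2..k}. \<xi> i * h i \<noteq> 0 \<and>
      hom_less lt (LM (hom_less lt) (\<xi> i * h i)) (LM (hom_less lt) (\<xi> 1 * h 1))"
proof -
  from assms obtain \<xi> h xs where head: "\<xi> \<in> terms_t" "h \<in> A" "headed d \<sigma> (\<xi> * h)"
    and w: "w = \<xi> * h + (\<Sum>(\<xi>, h)\<leftarrow>xs. \<xi> * h)"
    and xs: "\<forall>(\<xi>, h)\<in>set xs. \<xi> \<in> terms_t \<and> h \<in> A \<and> \<xi> * h \<noteq> 0 \<and> below d \<sigma> (\<xi> * h)"
    unfolding headed_sums_def lower_sums_def by blast
  define ys where "ys = (\<xi>, h) # xs"
  define \<Xi> where "\<Xi> i = fst (ys ! (i - 1))" for i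
  define \<H> where "\<H> i = snd (ys ! (i - 1))" for i
  have first: "\<Xi> 1 = \<xi>" "\<H> 1 = h"
    by (simp_all add: \<Xi>_def \<H>_def ys_def)
  have rest: "\<Xi> i \<in> terms_t \<and> \<H> i \<in> A \<and> \<Xi> i * \<H> i \<noteq> 0 \<and> below d \<sigma> (\<Xi> i * \<H> i)"
    if "i \<in> {2..length ys}" for i
  proof -
    have "ys ! (i - 1) = xs ! (i - 2)" "i - 2 < length xs"
      using that by (auto simp: ys_def nth_Cons' numeral_2_eq_2)
    then show ?thesis
      using bspec[OF xs, of "xs ! (i - 2)"] by (simp add: \<Xi>_def \<H>_def split: prod.splits)
  qed
  have "(\<Sum>i=1..length ys. \<Xi> i * \<H> i) = (\<Sum>i<length ys. (\<lambda>(\<xi>, h). \<xi> * h) (ys ! i))"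
    by (simp add: sum.atLeast1_atMost_eq \<Xi>_def \<H>_def case_prod_beta)
  also have "\<dots> = (\<Sum>(\<xi>, h)\<leftarrow>ys. \<xi> * h)"
    by (simp add: sum_list_sum_nth atLeast0LessThan)
  finally have sum: "w = (\<Sum>i=1..length ys. \<Xi> i * \<H> i)"
    by (simp add: w ys_def)
  have "below d \<sigma> (\<Sum>(\<xi>, h)\<leftarrow>xs. \<xi> * h)"
    using xs by (induction xs) (auto intro: below_add)
  then have head_w: "headed d \<sigma> w"
    unfolding w by (rule headed_add_below[OF head(3)])
  have LM: "LM (hom_less lt) w = LM (hom_less lt) (\<Xi> 1 * \<H> 1)"
    unfolding first using LM_headed[OF head_w] LM_headed[OF head(3)] by (intro tmon_eqI) simp_all
  have all: "\<Xi> i \<in> terms_t \<and> \<H> i \<in> A" if "i \<in> {1..length ys}" for i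
    using rest[of i] first head(1,2) that by (cases "i = 1") auto
  have nonzero: "\<Xi> 1 * \<H> 1 \<noteq> 0"
    unfolding first using head(3) by (rule headed_nonzero)
  have lower: "\<Xi> i * \<H> i \<noteq> 0 \<and>
      hom_less lt (LM (hom_less lt) (\<Xi> i * \<H> i)) (LM (hom_less lt) (\<Xi> 1 * \<H> 1))"
    if "i \<in> {2..length ys}" for i
    using LM_below_headed[OF _ _ head(3), of "\<Xi> i * \<H> i"] rest[OF that] unfolding first by blast
  have len: "1 \<le> length ys" by (simp add: ys_def)
  show thesis
    by (rule that[of "length ys" \<Xi> \<H>, OF ballI sum len nonzero LM ballI]) (fact all lower)+
qed

end

theorem proposition3p8:
  fixes L :: "(real^'n::finite \<Rightarrow> real) set"
    and \<delta> :: "real^'n"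
    and less0 :: "'n mon \<Rightarrow> 'n mon \<Rightarrow> bool"
    and G :: "('n, 'k::field) tpol list"
    and f :: "('n, 'k) tpol"
    and S :: "(real^'n \<Rightarrow> real) \<Rightarrow> 'n mon set"
    and b :: "'n mon \<Rightarrow> 'n mon"
  assumes "finite L" and "L \<noteq> {}"
    and "\<forall>l\<in>L. linear l \<and> l \<noteq> (\<lambda>_. 0)"
    and "rational_forms L"
    and "\<forall>i. \<delta> $ i \<in> \<rat> \<and> 0 \<le> \<delta> $ i"
    and "semigroup_ordering less0"
    and "normal_ordering TYPE('k) (newton_less L \<delta> less0)"
    and "\<forall>g\<in>set G. homogeneous g"
    and "homogeneous f" and "f \<in> ideal_gen (set G)"
    and "\<forall>l\<in>L. finite (S l) \<and>
           generates_over (Ralg L l) (S l) (Rmod L \<delta> less0 {dehom f} l)"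
    and "\<forall>\<beta>\<in>(\<Union>l\<in>L. S l). LM (newton_less L \<delta> less0) (xmon (b \<beta>) * dehom f) = \<beta>"
  shows "reducing_set (newton_less L \<delta> less0) f G (b ` (\<Union>l\<in>L. S l))"
proof -
  interpret newton_order L \<delta> less0
    by (rule newton_order.intro[OF assms(1,2) _ assms(6)]) (use assms(3) in blast)
  interpret normal_mon_order "newton_less L \<delta> less0" "TYPE('k)"
    by (rule normal_mon_order.intro[OF total_mon_order_axioms])
      (rule normal_mon_order_axioms.intro[OF assms(7)])
  let ?T = "hom_less lt"
  let ?R = "b ` (\<Union>l\<in>L. S l)"
  let ?A = "set G \<union> {q. \<exists>\<beta>\<in>?R. normal_form lt (txmon 0 \<beta> * f) G = Some q}"
  have unit: "homogeneous u" "dehom u \<noteq> 0" "LM lt (dehom u) = 0"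
    if "headed D 0 u" for D and u :: "('n, 'k) tpol"
    using headed_hom[OF that] headed_dehom[OF that] unfolding homogeneous_iff by blast+
  have "\<exists>g (k :: nat) \<xi> h.
      homogeneous g \<and> dehom g \<noteq> 0 \<and> LM lt (dehom g) = 0 \<and>
      (\<forall>i\<in>{1..k}. \<xi> i \<in> terms_t \<and> h i \<in> ?A) \<and>
      g * txmon 0 \<alpha> * f = (\<Sum>i=1..k. \<xi> i * h i) \<and>
      (f \<noteq> 0 \<longrightarrow> 1 \<le> k \<and>
        \<xi> 1 * h 1 \<noteq> 0 \<and>
        LM ?T (g * txmon 0 \<alpha> * f) = LM ?T (\<xi> 1 * h 1) \<and>
        (\<forall>i\<in>{2..k}. \<xi> i * h i \<noteq> 0 \<and>
          hom_less lt (LM ?T (\<xi> i * h i)) (LM ?T (\<xi> 1 * h 1))))" for \<alpha>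
  proof (cases "f = 0")
    case True
    then show ?thesis
      using unit[OF headed_one] by (intro exI[of _ 1] exI[of _ 0]) simp
  next
    case False
    obtain df where hom_f: "hom_of_degree df f"
      using assms(9) unfolding homogeneous_iff by blast
    define F where "F = dehom f"
    have "F \<noteq> 0"
      unfolding F_def by (rule headed_dehom(2)[OF headed_LM[OF hom_f False]])
    define \<mu> where "\<mu> = LM lt (xmon \<alpha> * F)"
    have "\<mu> \<in> LMset lt {F}"
      using \<open>F \<noteq> 0\<close> unfolding LMset_def \<mu>_def by blast
    obtain l where l: "l \<in> L" "weight L \<delta> \<mu> = l (expvec \<mu> + \<delta>)"
      by (rule weight_attained)
    then have "\<mu> \<in> mon_cone L \<delta> l" by (simp add: mon_cone_def)
    have S: "finite (S l)" "generates_over (Ralg L l) (S l) (Rmod L \<delta> less0 {F} l)"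
      using assms(11) l(1) by (auto simp: F_def)
    obtain \<gamma> \<sigma> where \<sigma>: "\<sigma> \<in> S l" "\<sigma> \<in> mon_cone L \<delta> l"
      and \<gamma>: "\<gamma> \<in> mon_cone L 0 l" and \<mu>: "\<mu> = \<gamma> + \<sigma>"
      using module_generator_divides[OF l(1) S \<open>\<mu> \<in> LMset lt {F}\<close> \<open>\<mu> \<in> mon_cone L \<delta> l\<close>] by metis
    define p where "p = txmon 0 (b \<sigma>) * f"
    define d where "d = tdeg (0, b \<sigma>) + df"
    have "LM lt (xmon (b \<sigma>) * F) = \<sigma>"
      using assms(12) \<sigma>(1) l(1) by (auto simp: F_def)
    then have p: "headed d \<sigma> p"
      using headed_xmon_multiple[OF hom_f False, of "b \<sigma>"] by (simp add: p_def d_def F_def)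
    note shift = cone_shift[OF l(1) \<gamma> \<sigma>(2)]
    have "headed (tdeg (0, \<gamma>) + d) (\<gamma> + \<sigma>) (txmon 0 \<gamma> * p)"
      unfolding txmon_def by (rule headed_single_mult[OF p one_neq_zero shift])
    moreover have "txmon 0 \<gamma> * p = txmon 0 (\<gamma> + b \<sigma>) * f"
      by (simp add: p_def txmon_mult flip: mult.assoc)
    ultimately have "LM lt (xmon (\<gamma> + b \<sigma>) * F) = \<mu>"
      using LM_headed(2) headed_xmon_multiple[OF hom_f False, of "\<gamma> + b \<sigma>"] unfolding \<mu> F_def by metis
    then have \<alpha>: "\<alpha> = \<gamma> + b \<sigma>"
      using LM_xmon_mult_inj[OF \<open>F \<noteq> 0\<close>] unfolding \<mu>_def by metis
    have wqo: "\<exists>i j. i < j \<and> reduces_monomial (m i) (m j)"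
      if "\<And>i j. i < j \<Longrightarrow> lt (snd (m j)) (snd (m i))" for m :: "nat \<Rightarrow> 'n tmon"
      unfolding reduces_monomial_def
      by (rule decreasing_sequence_reduces[OF assms(4,5)]) (rule that)
    obtain q where q: "normal_form lt p G = Some q"
      using normal_form_terminates[OF p assms(8) wqo] by blast
    obtain D u where u: "headed D 0 u" and up: "u * p \<in> headed_sums (set G \<union> {q}) (D + d) \<sigma>"
      using normal_form_headed_sum[OF p assms(8) q] by blast
    have scaled: "txmon 0 \<gamma> * (u * p) \<in> headed_sums (set G \<union> {q}) (tdeg (0, \<gamma>) + (D + d)) (\<gamma> + \<sigma>)"
      unfolding txmon_def
    proof (rule headed_sums_single_mult[OF up one_neq_zero])
      fix r :: "('n, 'k) tpol"
      show "below (tdeg (0, \<gamma>) + (D + d)) (\<gamma> + \<sigma>) (Poly_Mapping.single (0, \<gamma>) 1 * r)"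
        if "below (D + d) \<sigma> r"
        by (rule below_single_mult[OF that shift])
      show "headed (tdeg (0, \<gamma>) + (D + d)) (\<gamma> + \<sigma>) (Poly_Mapping.single (0, \<gamma>) 1 * r)"
        if "headed (D + d) \<sigma> r"
        by (rule headed_single_mult[OF that one_neq_zero shift])
    qed
    have used: "set G \<union> {q} \<subseteq> ?A"
      using q \<sigma>(1) l(1) by (auto simp: p_def)
    have "txmon 0 \<gamma> * (u * p) = u * txmon 0 \<alpha> * f"
      by (simp add: p_def \<alpha> ac_simps flip: txmon_mult[of 0 \<gamma> 0 "b \<sigma>", simplified])
    with subsetD[OF headed_sums_mono[OF used] scaled]
    have "u * txmon 0 \<alpha> * f \<in> headed_sums ?A (tdeg (0, \<gamma>) + (D + d)) (\<gamma> + \<sigma>)"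
      by (simp only:)
    then obtain k :: nat and \<xi> h where all: "\<forall>i\<in>{1..k}. \<xi> i \<in> terms_t \<and> h i \<in> ?A"
      and sum: "u * txmon 0 \<alpha> * f = (\<Sum>i=1..k. \<xi> i * h i)"
      and lead: "1 \<le> k" "\<xi> 1 * h 1 \<noteq> 0" "LM ?T (u * txmon 0 \<alpha> * f) = LM ?T (\<xi> 1 * h 1)"
      and rest: "\<forall>i\<in>{2..k}. \<xi> i * h i \<noteq> 0 \<and>
        hom_less lt (LM ?T (\<xi> i * h i)) (LM ?T (\<xi> 1 * h 1))"
      by (rule headed_sums_indexed)
    show ?thesis
      by (rule exI[of _ u], rule exI[of _ k], rule exI[of _ \<xi>], rule exI[of _ h])
        (intro conjI impI unit[OF u] all sum lead rest)
  qed
  moreover have "finite ?R"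
    using assms(1,11) by auto
  ultimately show ?thesis
    unfolding reducing_set_def by simp
qed

end
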